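(* Let $S_{\mathbb{N}}$ be the group of all finitely supported permutations of the set $\mathbb{N}$ of positive integers, and let $A_{\mathbb{N}}\le S_{\mathbb{N}}$ be the subgroup of all even permutations. Let $P\subseteq L(S_{\mathbb{N}})$ be an invariant von Neumann subalgebra, i.e. a von Neumann subalgebra with $u_gPu_g^{*}=P$ for all $g\in S_{\mathbb{N}}$. Then $P=\mathbb{C}$, $P=L(A_{\mathbb{N}})$ or $P=L(S_{\mathbb{N}})$.
   Context: $\mathbb{N}=\{1,2,3,\ldots\}$. A permutation $s$ of $\mathbb{N}$ is finitely supported if $\{i\in\mathbb{N}: s(i)\neq i\}$ is finite; such a permutation is even if it is a product of an even number of transpositions. For a countable discrete group $G$, $L(G)\subseteq B(\ell^2(G))$ denotes the group von Neumann algebra, i.e. the von Neumann algebra generated by the left regular representation unitaries $u_g$, $g\in G$ ($u_g\delta_h=\delta_{gh}$). For a subgroup $H\le G$, $L(H)$ is identified with the von Neumann subalgebra of $L(G)$ generated by $\{u_h:h\in H\}$. Von Neumann subalgebras are unital, i.e. contain the identity $1=u_e$ of $L(G)$, and $\mathbb{C}$ denotes $\mathbb{C}1$. *)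

theory Defs
  imports "HOL-Analysis.Analysis" "HOL-Combinatorics.Permutations" "HOL-Combinatorics.Perm"
begin

section \<open>The Hilbert space of square-summable functions\<close>

definition square_summable :: "('g \<Rightarrow> complex) \<Rightarrow> bool" where
  "square_summable f \<longleftrightarrow> (\<lambda>h. (cmod (f h))\<^sup>2) summable_on UNIV"

lemma square_summable_prod:
  assumes "square_summable f" "square_summable g"
  shows "(\<lambda>h. cmod (f h) * cmod (g h)) summable_on UNIV"
proof (rule summable_on_comparison_test)
  show "(\<lambda>h. (cmod (f h))\<^sup>2 + (cmod (g h))\<^sup>2) summable_on UNIV"
    using assms unfolding square_summable_def by (rule summable_on_add)
  fix h
  have "2 * (cmod (f h) * cmod (g h)) \<le> (cmod (f h))\<^sup>2 + (cmod (g h))\<^sup>2"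
    using sum_squares_bound[of "cmod (f h)" "cmod (g h)"] by (simp add: mult.assoc)
  moreover have "0 \<le> cmod (f h) * cmod (g h)" by simp
  ultimately show "cmod (f h) * cmod (g h) \<le> (cmod (f h))\<^sup>2 + (cmod (g h))\<^sup>2" by linarith
qed simp

lemma square_summable_zero: "square_summable (\<lambda>_. 0)"
  by (simp add: square_summable_def)

lemma square_summable_add:
  assumes "square_summable f" "square_summable g"
  shows "square_summable (\<lambda>h. f h + g h)"
  unfolding square_summable_def
proof (rule summable_on_comparison_test)
  show "(\<lambda>h. ((cmod (f h))\<^sup>2 + (cmod (g h))\<^sup>2) + 2 * (cmod (f h) * cmod (g h))) summable_on UNIV"
    using assms square_summable_prod[OF assms] unfolding square_summable_def
    by (intro summable_on_add summable_on_cmult_right)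
  fix h
  have "(cmod (f h + g h))\<^sup>2 \<le> (cmod (f h) + cmod (g h))\<^sup>2"
    by (intro power_mono norm_triangle_ineq) simp
  then show "(cmod (f h + g h))\<^sup>2
      \<le> ((cmod (f h))\<^sup>2 + (cmod (g h))\<^sup>2) + 2 * (cmod (f h) * cmod (g h))"
    by (simp add: power2_sum mult.assoc)
qed simp

lemma square_summable_cmult:
  assumes "square_summable f"
  shows "square_summable (\<lambda>h. c * f h)"
  using assms unfolding square_summable_def
  by (simp add: norm_mult power_mult_distrib summable_on_cmult_right)

typedef 'g ell2 = "{f :: 'g \<Rightarrow> complex. square_summable f}"
  morphisms ell2_apply Abs_ell2
  using square_summable_zero by blast

setup_lifting type_definition_ell2

lemma square_summable_ell2_apply [simp]: "square_summable (ell2_apply f)"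
  using ell2_apply[of f] by simp

lemma ell2_eqI: "(\<And>h. ell2_apply f h = ell2_apply g h) \<Longrightarrow> f = g"
  by transfer auto

lift_definition scaleC_ell2 :: "complex \<Rightarrow> 'g ell2 \<Rightarrow> 'g ell2" is "\<lambda>c f h. c * f h"
  by (rule square_summable_cmult)

text \<open>The inner product is conjugate-linear in its first argument.\<close>

definition cinner_ell2 :: "'g ell2 \<Rightarrow> 'g ell2 \<Rightarrow> complex" where
  "cinner_ell2 f g = (\<Sum>\<^sub>\<infinity>h. cnj (ell2_apply f h) * ell2_apply g h)"

lemma cinner_summable:
  "(\<lambda>h. cnj (ell2_apply f h) * ell2_apply g h) summable_on UNIV"
proof (rule abs_summable_summable)
  show "(\<lambda>h. norm (cnj (ell2_apply f h) * ell2_apply g h)) summable_on UNIV"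
    using square_summable_prod[of "ell2_apply f" "ell2_apply g"] by (simp add: norm_mult)
qed

instantiation ell2 :: (type) real_vector
begin

lift_definition zero_ell2 :: "'a ell2" is "\<lambda>_. 0"
  by (rule square_summable_zero)

lift_definition plus_ell2 :: "'a ell2 \<Rightarrow> 'a ell2 \<Rightarrow> 'a ell2" is "\<lambda>f g h. f h + g h"
  by (rule square_summable_add)

lift_definition uminus_ell2 :: "'a ell2 \<Rightarrow> 'a ell2" is "\<lambda>f h. - f h"
  by (simp add: square_summable_def)

definition minus_ell2 :: "'a ell2 \<Rightarrow> 'a ell2 \<Rightarrow> 'a ell2" where
  "minus_ell2 f g = f + - g"

definition scaleR_ell2 :: "real \<Rightarrow> 'a ell2 \<Rightarrow> 'a ell2" where
  "scaleR_ell2 r f = scaleC_ell2 (complex_of_real r) f"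

instance
proof
  fix f g k :: "'a ell2" and r s :: real
  show "f + g + k = f + (g + k)" "f + g = g + f" "0 + f = f" "- f + f = 0"
    by (transfer; simp add: algebra_simps)+
  show "f - g = f + - g" by (fact minus_ell2_def)
  show "r *\<^sub>R (f + g) = r *\<^sub>R f + r *\<^sub>R g" "(r + s) *\<^sub>R f = r *\<^sub>R f + s *\<^sub>R f"
    "r *\<^sub>R s *\<^sub>R f = (r * s) *\<^sub>R f" "1 *\<^sub>R f = f"
    unfolding scaleR_ell2_def by (transfer; simp add: algebra_simps)+
qed

end

instantiation ell2 :: (type) real_inner
begin

definition inner_ell2 :: "'a ell2 \<Rightarrow> 'a ell2 \<Rightarrow> real" where
  "inner_ell2 f g = Re (cinner_ell2 f g)"

definition norm_ell2 :: "'a ell2 \<Rightarrow> real" where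
  "norm_ell2 f = sqrt (inner f f)"

definition sgn_ell2 :: "'a ell2 \<Rightarrow> 'a ell2" where
  "sgn_ell2 f = f /\<^sub>R norm f"

definition dist_ell2 :: "'a ell2 \<Rightarrow> 'a ell2 \<Rightarrow> real" where
  "dist_ell2 f g = norm (f - g)"

definition uniformity_ell2 :: "('a ell2 \<times> 'a ell2) filter" where
  "uniformity_ell2 = (INF e\<in>{0<..}. principal {(f, g). dist f g < e})"

definition open_ell2 :: "'a ell2 set \<Rightarrow> bool" where
  "open_ell2 U \<longleftrightarrow> (\<forall>f\<in>U. \<forall>\<^sub>F (f', g) in uniformity. f' = f \<longrightarrow> g \<in> U)"

instance
proof
  fix f g k :: "'a ell2" and r s :: real
  show "sgn f = f /\<^sub>R norm f" by (fact sgn_ell2_def)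
  show "dist f g = norm (f - g)" by (fact dist_ell2_def)
  show "uniformity = (INF e\<in>{0<..}. principal {(f, g). dist (f::'a ell2) g < e})"
    by (fact uniformity_ell2_def)
  show "open U \<longleftrightarrow> (\<forall>f\<in>U. \<forall>\<^sub>F (f', g) in uniformity. f' = f \<longrightarrow> g \<in> U)" for U :: "'a ell2 set"
    by (fact open_ell2_def)
  have "cinner_ell2 g f = cnj (cinner_ell2 f g)"
    unfolding cinner_ell2_def by (simp add: infsum_cnj[symmetric] mult.commute)
  then show "inner f g = inner g f" by (simp add: inner_ell2_def)
  have "cinner_ell2 (f + g) k = cinner_ell2 f k + cinner_ell2 g k"
    unfolding cinner_ell2_def
    by (simp add: plus_ell2.rep_eq distrib_left distrib_right infsum_add cinner_summable)
  then show "inner (f + g) k = inner f k + inner g k" by (simp add: inner_ell2_def)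
  have "cinner_ell2 (r *\<^sub>R f) g = r * cinner_ell2 f g"
    unfolding cinner_ell2_def scaleR_ell2_def
    by (simp add: scaleC_ell2.rep_eq mult.assoc infsum_cmult_right')
  then show "inner (r *\<^sub>R f) g = r * inner f g" by (simp add: inner_ell2_def)
  have sq: "(\<lambda>h. (cmod (ell2_apply f h))\<^sup>2) summable_on UNIV"
    using square_summable_ell2_apply[of f] by (simp only: square_summable_def)
  have "cinner_ell2 f f = (\<Sum>\<^sub>\<infinity>h. complex_of_real ((cmod (ell2_apply f h))\<^sup>2))"
    unfolding cinner_ell2_def by (simp add: complex_norm_square mult.commute del: of_real_power)
  also have "\<dots> = complex_of_real (\<Sum>\<^sub>\<infinity>h. (cmod (ell2_apply f h))\<^sup>2)"
    using has_sum_infsum[OF sq] by (intro infsumI has_sum_of_real)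
  finally have eq: "inner f f = (\<Sum>\<^sub>\<infinity>h. (cmod (ell2_apply f h))\<^sup>2)"
    by (simp add: inner_ell2_def)
  show "0 \<le> inner f f" unfolding eq by (rule infsum_nonneg) simp
  show "inner f f = 0 \<longleftrightarrow> f = 0"
  proof
    assume "inner f f = 0"
    then have "(cmod (ell2_apply f h))\<^sup>2 = 0" for h
      using sq unfolding eq by (intro nonneg_infsum_le_0D[of _ UNIV]) auto
    then show "f = 0" by (intro ell2_eqI) (simp add: zero_ell2.rep_eq)
  next
    assume "f = 0" then show "inner f f = 0" unfolding eq by (simp add: zero_ell2.rep_eq)
  qed
  show "norm f = sqrt (inner f f)" by (fact norm_ell2_def)
qed

end

lemma cinner_commute: "cinner_ell2 g f = cnj (cinner_ell2 f g)"
  unfolding cinner_ell2_def by (simp add: infsum_cnj[symmetric] mult.commute)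

lemma cinner_add_right: "cinner_ell2 k (f + g) = cinner_ell2 k f + cinner_ell2 k g"
  unfolding cinner_ell2_def
  by (simp add: plus_ell2.rep_eq distrib_left distrib_right infsum_add cinner_summable)

lemma cinner_scaleC_right: "cinner_ell2 f (scaleC_ell2 c g) = c * cinner_ell2 f g"
  unfolding cinner_ell2_def
  by (simp add: scaleC_ell2.rep_eq mult.left_commute infsum_cmult_right')

lemma cinner_add_left: "cinner_ell2 (f + g) k = cinner_ell2 f k + cinner_ell2 g k"
  by (metis cinner_add_right cinner_commute complex_cnj_add)

lemma cinner_scaleC_left: "cinner_ell2 (scaleC_ell2 c f) g = cnj c * cinner_ell2 f g"
  by (metis cinner_scaleC_right cinner_commute complex_cnj_mult)

lemma cinner_self: "cinner_ell2 f f = complex_of_real ((norm f)\<^sup>2)"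
proof (rule complex_eqI)
  show "Re (cinner_ell2 f f) = Re (complex_of_real ((norm f)\<^sup>2))"
    by (simp add: power2_norm_eq_inner inner_ell2_def)
  show "Im (cinner_ell2 f f) = Im (complex_of_real ((norm f)\<^sup>2))"
    using cinner_commute[of f f] by (simp add: complex_eq_iff)
qed

lemma norm_ell2_sq: "(norm f)\<^sup>2 = (\<Sum>\<^sub>\<infinity>h. (cmod (ell2_apply f h))\<^sup>2)"
proof -
  have sq: "(\<lambda>h. (cmod (ell2_apply f h))\<^sup>2) summable_on UNIV"
    using square_summable_ell2_apply[of f] by (simp only: square_summable_def)
  have "cinner_ell2 f f = (\<Sum>\<^sub>\<infinity>h. complex_of_real ((cmod (ell2_apply f h))\<^sup>2))"
    unfolding cinner_ell2_def by (simp add: complex_norm_square mult.commute del: of_real_power)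
  also have "\<dots> = complex_of_real (\<Sum>\<^sub>\<infinity>h. (cmod (ell2_apply f h))\<^sup>2)"
    using has_sum_infsum[OF sq] by (intro infsumI has_sum_of_real)
  finally show ?thesis unfolding cinner_self by (simp only: of_real_eq_iff)
qed

lemma norm_scaleC_ell2: "norm (scaleC_ell2 c f) = cmod c * norm f"
proof -
  have "(norm (scaleC_ell2 c f))\<^sup>2 = (cmod c * norm f)\<^sup>2"
    unfolding norm_ell2_sq power_mult_distrib
    by (simp add: scaleC_ell2.rep_eq norm_mult power_mult_distrib infsum_cmult_right')
  then show ?thesis by (simp add: power2_eq_iff_nonneg)
qed

lemma cinner_Cauchy_Schwarz: "cmod (cinner_ell2 f g) \<le> norm f * norm g"
proof (cases "cinner_ell2 f g = 0")
  case False
  define c where "c = cnj (sgn (cinner_ell2 f g))"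
  have c: "cmod c = 1" using False by (simp add: c_def norm_sgn)
  have "c * cinner_ell2 f g = complex_of_real (cmod (cinner_ell2 f g))"
    using False unfolding c_def sgn_eq
    by (simp add: divide_simps complex_norm_square[symmetric] power2_eq_square mult.commute
        flip: of_real_mult)
  then have "cmod (cinner_ell2 f g) = inner f (scaleC_ell2 c g)"
    by (simp add: inner_ell2_def cinner_scaleC_right)
  also have "\<dots> \<le> norm f * norm (scaleC_ell2 c g)" by (rule norm_cauchy_schwarz)
  finally show ?thesis by (simp add: norm_scaleC_ell2 c)
qed simp

lift_definition delta :: "'g \<Rightarrow> 'g ell2" is "\<lambda>g h. if h = g then 1 else 0"
proof -
  fix g :: 'g
  have "(\<lambda>h. (cmod (if h = g then 1 else 0))\<^sup>2) summable_on UNIV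
      \<longleftrightarrow> (\<lambda>h. (cmod (if h = g then 1 else 0))\<^sup>2) summable_on {g}"
    by (rule summable_on_cong_neutral) auto
  then show "square_summable (\<lambda>h. if h = g then 1 else (0::complex))"
    by (simp add: square_summable_def)
qed

lemma cinner_delta: "cinner_ell2 (delta h) f = ell2_apply f h"
proof -
  have "cinner_ell2 (delta h) f = infsum (\<lambda>k. cnj (ell2_apply (delta h) k) * ell2_apply f k) {h}"
    unfolding cinner_ell2_def by (rule infsum_cong_neutral) (auto simp: delta.rep_eq)
  then show ?thesis by (simp add: delta.rep_eq)
qed


lemma minus_ell2_apply: "ell2_apply (f - g) h = ell2_apply f h - ell2_apply g h"
  unfolding minus_ell2_def plus_ell2.rep_eq uminus_ell2.rep_eq by simp

lemma ell2_sum_apply: "ell2_apply (sum F A) h = (\<Sum>x\<in>A. ell2_apply (F x) h)"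
  by (induction A rule: infinite_finite_induct) (simp_all add: zero_ell2.rep_eq plus_ell2.rep_eq)

lemma cinner_zero [simp]: "cinner_ell2 0 f = 0" "cinner_ell2 f 0 = 0"
  by (simp_all add: cinner_ell2_def zero_ell2.rep_eq)

lemma cinner_sum_left: "cinner_ell2 (sum F A) f = (\<Sum>x\<in>A. cinner_ell2 (F x) f)"
  by (induction A rule: infinite_finite_induct) (simp_all add: cinner_add_left)

lemma cinner_sum_right: "cinner_ell2 f (sum F A) = (\<Sum>x\<in>A. cinner_ell2 f (F x))"
  by (induction A rule: infinite_finite_induct) (simp_all add: cinner_add_right)

definition truncate :: "'g set \<Rightarrow> 'g ell2 \<Rightarrow> 'g ell2" where
  "truncate A f = (\<Sum>h\<in>A. scaleC_ell2 (ell2_apply f h) (delta h))"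

lemma truncate_apply:
  "finite A \<Longrightarrow> ell2_apply (truncate A f) h = (if h \<in> A then ell2_apply f h else 0)"
  by (simp add: truncate_def ell2_sum_apply scaleC_ell2.rep_eq delta.rep_eq if_distrib cong: if_cong)

lemma norm_truncate_sq:
  assumes "finite A"
  shows "(norm (truncate A f))\<^sup>2 = (\<Sum>h\<in>A. (cmod (ell2_apply f h))\<^sup>2)"
proof -
  have "(norm (truncate A f))\<^sup>2 = infsum (\<lambda>h. (cmod (ell2_apply f h))\<^sup>2) A"
    unfolding norm_ell2_sq by (rule infsum_cong_neutral) (auto simp: truncate_apply assms)
  then show ?thesis using assms by simp
qed

lemma truncate_tendsto: "((\<lambda>A. truncate A f) \<longlongrightarrow> f) (finite_subsets_at_top UNIV)"
proof -
  let ?s = "\<lambda>h. (cmod (ell2_apply f h))\<^sup>2"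
  have sq: "?s summable_on UNIV"
    using square_summable_ell2_apply[of f] by (simp only: square_summable_def)
  have eq: "(norm (truncate A f - f))\<^sup>2 = (norm f)\<^sup>2 - sum ?s A" if "finite A" for A
  proof -
    have "(norm (truncate A f - f))\<^sup>2 = infsum ?s (UNIV - A)"
      unfolding norm_ell2_sq
      by (rule infsum_cong_neutral)
        (auto simp: minus_ell2_apply truncate_apply that)
    also have "\<dots> = infsum ?s UNIV - infsum ?s A"
      by (rule infsum_Diff) (use sq that in auto)
    finally show ?thesis using that by (simp add: norm_ell2_sq)
  qed
  have "(sum ?s \<longlongrightarrow> (norm f)\<^sup>2) (finite_subsets_at_top UNIV)"
    using has_sum_infsum[OF sq] unfolding has_sum_def norm_ell2_sq .
  then have "((\<lambda>A. (norm f)\<^sup>2 - sum ?s A) \<longlongrightarrow> 0) (finite_subsets_at_top UNIV)"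
    by (auto intro: tendsto_eq_intros)
  then have "((\<lambda>A. (norm (truncate A f - f))\<^sup>2) \<longlongrightarrow> 0) (finite_subsets_at_top UNIV)"
    by (rule Lim_transform_eventually) (auto intro!: eventually_finite_subsets_at_top_weakI simp: eq)
  then have "((\<lambda>A. sqrt ((norm (truncate A f - f))\<^sup>2)) \<longlongrightarrow> sqrt 0) (finite_subsets_at_top UNIV)"
    by (rule tendsto_real_sqrt)
  then have "((\<lambda>A. norm (truncate A f - f)) \<longlongrightarrow> 0) (finite_subsets_at_top UNIV)"
    by simp
  then have "((\<lambda>A. truncate A f - f) \<longlongrightarrow> 0) (finite_subsets_at_top UNIV)"
    by (rule tendsto_norm_zero_cancel)
  then show ?thesis by (rule LIM_zero_cancel)
qed

lemma bounded_linear_cinner_right: "bounded_linear (\<lambda>g. cinner_ell2 f g)"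
proof (rule bounded_linear_intro)
  show "cinner_ell2 f (g + k) = cinner_ell2 f g + cinner_ell2 f k" for g k
    by (rule cinner_add_right)
  show "cinner_ell2 f (r *\<^sub>R g) = r *\<^sub>R cinner_ell2 f g" for r g
    by (simp add: scaleR_ell2_def cinner_scaleC_right scaleR_conv_of_real)
  show "norm (cinner_ell2 f g) \<le> norm g * norm f" for g
    using cinner_Cauchy_Schwarz[of f g] by (simp add: mult.commute)
qed

lemma cinner_eqI:
  assumes "\<And>k. cinner_ell2 f k = cinner_ell2 g k"
  shows "f = g"
  by (rule ell2_eqI) (metis assms cinner_commute cinner_delta)


section \<open>Bounded operators and von Neumann algebras\<close>

text \<open>
  The type \<open>'g ell2 \<Rightarrow>\<^sub>L 'g ell2\<close> consists of the real-linear bounded operators; the elements of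
  $B(\ell^2)$ are the complex-linear ones among them.
\<close>

definition bounded_operators :: "('g ell2 \<Rightarrow>\<^sub>L 'g ell2) set" where
  "bounded_operators = {T :: 'g ell2 \<Rightarrow>\<^sub>L 'g ell2. \<forall>c f. T (scaleC_ell2 c f) = scaleC_ell2 c (T f)}"

text \<open>Existence and uniqueness are shown in \<open>cinner_adjoint_op\<close> below, for complex-linear \<open>T\<close>.\<close>

definition adjoint_op :: "('g ell2 \<Rightarrow>\<^sub>L 'g ell2) \<Rightarrow> ('g ell2 \<Rightarrow>\<^sub>L 'g ell2)" where
  "adjoint_op T = (THE S :: 'g ell2 \<Rightarrow>\<^sub>L 'g ell2. \<forall>f g. cinner_ell2 (S f) g = cinner_ell2 f (T g))"

lift_definition scalar_op :: "complex \<Rightarrow> 'g ell2 \<Rightarrow>\<^sub>L 'g ell2" is scaleC_ell2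
proof (rule bounded_linear_intro)
  fix c :: complex and f g :: "'g ell2" and r :: real
  show "scaleC_ell2 c (f + g) = scaleC_ell2 c f + scaleC_ell2 c g"
    by (rule ell2_eqI) (simp add: scaleC_ell2.rep_eq plus_ell2.rep_eq distrib_left)
  show "scaleC_ell2 c (r *\<^sub>R f) = r *\<^sub>R scaleC_ell2 c f"
    by (rule ell2_eqI) (simp add: scaleR_ell2_def scaleC_ell2.rep_eq)
  show "norm (scaleC_ell2 c f) \<le> norm f * cmod c"
    by (simp add: norm_scaleC_ell2 mult.commute)
qed

text \<open>
  For unital *-subalgebras of $B(\ell^2)$, being closed in the strong operator topology, being
  closed in the weak operator topology and equality with the bicommutant coincide.  Every such
  algebra contains the identity of $B(\ell^2)$, so subalgebras are unital with the same unit.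
\<close>

definition von_neumann_algebra :: "('g ell2 \<Rightarrow>\<^sub>L 'g ell2) set \<Rightarrow> bool" where
  "von_neumann_algebra M \<longleftrightarrow>
     M \<subseteq> bounded_operators \<and>
     id_blinfun \<in> M \<and>
     (\<forall>S\<in>M. \<forall>T\<in>M. S + T \<in> M) \<and>
     (\<forall>S\<in>M. \<forall>T\<in>M. S o\<^sub>L T \<in> M) \<and>
     (\<forall>c. \<forall>T\<in>M. scalar_op c o\<^sub>L T \<in> M) \<and>
     (\<forall>T\<in>M. adjoint_op T \<in> M) \<and>
     closedin strong_operator_topology M"

lemma cinner_adjoint_op:
  assumes "T \<in> bounded_operators"
  shows "cinner_ell2 (adjoint_op T f) g = cinner_ell2 f (T g)"
proof -
  have bound: "(\<Sum>h\<in>A. (cmod (cinner_ell2 (T (delta h)) k))\<^sup>2) \<le> (norm T * norm k)\<^sup>2"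
    if "finite A" for A k
  proof -
    define c where "c h = cinner_ell2 (T (delta h)) k" for h
    define v where "v = (\<Sum>h\<in>A. scaleC_ell2 (c h) (delta h))"
    have vapp: "ell2_apply v h = (if h \<in> A then c h else 0)" for h
      using that
      by (simp add: v_def ell2_sum_apply scaleC_ell2.rep_eq delta.rep_eq if_distrib cong: if_cong)
    have "(norm v)\<^sup>2 = infsum (\<lambda>h. (cmod (c h))\<^sup>2) A"
      unfolding norm_ell2_sq by (rule infsum_cong_neutral) (auto simp: vapp)
    then have nv: "(norm v)\<^sup>2 = (\<Sum>h\<in>A. (cmod (c h))\<^sup>2)" using that by simp
    have "T v = (\<Sum>h\<in>A. scaleC_ell2 (c h) (T (delta h)))"
      using assms by (simp add: v_def blinfun.sum_right bounded_operators_def)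
    then have "cinner_ell2 (T v) k = (\<Sum>h\<in>A. cnj (c h) * c h)"
      by (simp add: cinner_sum_left cinner_scaleC_left c_def)
    also have "\<dots> = complex_of_real ((norm v)\<^sup>2)"
      unfolding nv of_real_sum by (simp add: complex_norm_square mult.commute del: of_real_power)
    finally have "(norm v)\<^sup>2 = cmod (cinner_ell2 (T v) k)"
      by (simp add: norm_power)
    also have "\<dots> \<le> norm (T v) * norm k" by (rule cinner_Cauchy_Schwarz)
    also have "\<dots> \<le> norm T * norm v * norm k"
      by (intro mult_right_mono norm_blinfun) simp
    finally have "norm v * norm v \<le> norm v * (norm T * norm k)"
      by (simp add: power2_eq_square mult.assoc mult.left_commute)
    then have "norm v \<le> norm T * norm k"
      by (cases "norm v = 0") (auto simp: mult_le_cancel_left)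
    then have "(norm v)\<^sup>2 \<le> (norm T * norm k)\<^sup>2" by (intro power_mono) auto
    then show ?thesis by (simp add: nv c_def)
  qed
  have sum: "square_summable (\<lambda>h. cinner_ell2 (T (delta h)) k)" for k
    unfolding square_summable_def
    by (rule nonneg_bdd_above_summable_on)
      (auto intro!: bdd_aboveI[where M = "(norm T * norm k)\<^sup>2"] bound)
  define S where "S k = Abs_ell2 (\<lambda>h. cinner_ell2 (T (delta h)) k)" for k
  have Sapp: "ell2_apply (S k) h = cinner_ell2 (T (delta h)) k" for k h
    unfolding S_def by (simp add: Abs_ell2_inverse sum)
  have "bounded_linear S"
  proof (rule bounded_linear_intro)
    show "S (k + l) = S k + S l" for k l
      by (rule ell2_eqI) (simp add: Sapp plus_ell2.rep_eq cinner_add_right)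
    show "S (r *\<^sub>R k) = r *\<^sub>R S k" for r k
      by (rule ell2_eqI) (simp add: Sapp scaleR_ell2_def scaleC_ell2.rep_eq cinner_scaleC_right)
    show "norm (S k) \<le> norm k * norm T" for k
    proof -
      have "(norm (S k))\<^sup>2 \<le> (norm T * norm k)\<^sup>2"
        unfolding norm_ell2_sq Sapp
        by (rule infsum_le_finite_sums)
          (use sum bound in \<open>auto simp: square_summable_def\<close>)
      then show ?thesis by (simp add: abs_le_square_iff[symmetric] mult.commute)
    qed
  qed
  then have S: "blinfun_apply (Blinfun S) = S" by (rule bounded_linear_Blinfun_apply)
  have adj: "cinner_ell2 (S k) l = cinner_ell2 k (T l)" for k l
  proof -
    have trunc: "cinner_ell2 (S k) (truncate A l) = cinner_ell2 k (T (truncate A l))" for A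
    proof -
      have "cinner_ell2 (S k) (delta h) = cinner_ell2 k (T (delta h))" for h
        using cinner_commute[of "S k" "delta h"] cinner_commute[of k "T (delta h)"]
        by (simp add: cinner_delta Sapp)
      then show ?thesis
        using assms
        by (simp add: truncate_def blinfun.sum_right bounded_operators_def cinner_sum_right
            cinner_scaleC_right)
    qed
    have "((\<lambda>A. cinner_ell2 (S k) (truncate A l)) \<longlongrightarrow> cinner_ell2 (S k) l)
        (finite_subsets_at_top UNIV)"
      by (rule bounded_linear.tendsto[OF bounded_linear_cinner_right truncate_tendsto])
    moreover have "((\<lambda>A. cinner_ell2 k (T (truncate A l))) \<longlongrightarrow> cinner_ell2 k (T l))
        (finite_subsets_at_top UNIV)"
      by (intro bounded_linear.tendsto[OF bounded_linear_cinner_right]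
          bounded_linear.tendsto[OF blinfun.bounded_linear_right] truncate_tendsto)
    ultimately show ?thesis
      unfolding trunc by (rule tendsto_unique[OF finite_subsets_at_top_neq_bot])
  qed
  have "\<forall>f g. cinner_ell2 (adjoint_op T f) g = cinner_ell2 f (T g)"
    unfolding adjoint_op_def
  proof (rule theI)
    show "\<forall>f g. cinner_ell2 (Blinfun S f) g = cinner_ell2 f (T g)" by (simp add: S adj)
    fix S' :: "'a ell2 \<Rightarrow>\<^sub>L 'a ell2"
    assume "\<forall>f g. cinner_ell2 (S' f) g = cinner_ell2 f (T g)"
    then show "S' = Blinfun S"
      by (intro blinfun_eqI cinner_eqI) (simp add: S adj)
  qed
  then show ?thesis by simp
qed

lemma adjoint_op_in_bounded_operators:
  assumes "T \<in> bounded_operators"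
  shows "adjoint_op T \<in> bounded_operators"
  unfolding bounded_operators_def
  by (auto intro!: cinner_eqI simp: cinner_adjoint_op[OF assms] cinner_scaleC_left)

lemma closedin_bounded_operators:
  "closedin strong_operator_topology (bounded_operators :: ('g ell2 \<Rightarrow>\<^sub>L 'g ell2) set)"
proof -
  define D :: "complex \<times> 'g ell2 \<Rightarrow> ('g ell2 \<Rightarrow>\<^sub>L 'g ell2) \<Rightarrow> 'g ell2"
    where "D = (\<lambda>(c, f) T. T (scaleC_ell2 c f) - scalar_op c (T f))"
  have "continuous_map strong_operator_topology euclidean (D p)" for p
  proof -
    obtain c f where p: "p = (c, f)" by fastforce
    have "continuous_map strong_operator_topology euclidean
        (\<lambda>T :: 'g ell2 \<Rightarrow>\<^sub>L 'g ell2. scalar_op c (T f))"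
      using continuous_map_compose[OF strong_operator_topology_continuous_evaluation[of f],
          of euclidean "blinfun_apply (scalar_op c)"]
      by (simp add: o_def continuous_map_iff_continuous2 blinfun.continuous_on)
    then show ?thesis
      unfolding D_def p prod.case
      by (intro continuous_map_diff strong_operator_topology_continuous_evaluation)
  qed
  then have "closedin strong_operator_topology {T \<in> topspace strong_operator_topology. D p T \<in> {0}}"
    for p
    by (rule closedin_continuous_map_preimage) simp
  then have "closedin strong_operator_topology
      (\<Inter>p. {T \<in> topspace strong_operator_topology. D p T \<in> {0}})"
    by (intro closedin_Inter) auto
  also have "(\<Inter>p. {T \<in> topspace strong_operator_topology. D p T \<in> {0}}) = bounded_operators"
    by (auto simp: D_def bounded_operators_def strong_operator_topology_topspace scalar_op.rep_eq)
  finally show ?thesis .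
qed

lemma von_neumann_algebra_bounded_operators: "von_neumann_algebra bounded_operators"
proof -
  have "scaleC_ell2 c (f + g) = scaleC_ell2 c f + scaleC_ell2 c g" for c and f g :: "'a ell2"
    by (rule ell2_eqI) (simp add: scaleC_ell2.rep_eq plus_ell2.rep_eq distrib_left)
  moreover have "scaleC_ell2 c (scaleC_ell2 d f) = scaleC_ell2 d (scaleC_ell2 c f)"
    for c d and f :: "'a ell2"
    by (rule ell2_eqI) (simp add: scaleC_ell2.rep_eq)
  ultimately show ?thesis
    unfolding von_neumann_algebra_def
    by (intro conjI ballI allI closedin_bounded_operators adjoint_op_in_bounded_operators)
      (auto simp: bounded_operators_def blinfun.add_left scalar_op.rep_eq)
qed

lemma von_neumann_algebra_Inter:
  assumes "\<F> \<noteq> {}" "\<And>M. M \<in> \<F> \<Longrightarrow> von_neumann_algebra M"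
  shows "von_neumann_algebra (\<Inter>\<F>)"
proof -
  have "closedin strong_operator_topology (\<Inter>\<F>)"
    using assms by (intro closedin_Inter) (auto simp: von_neumann_algebra_def)
  then show ?thesis
    using assms unfolding von_neumann_algebra_def by blast
qed

lemma von_neumann_algebra_hull:
  assumes "X \<subseteq> bounded_operators"
  shows "von_neumann_algebra (von_neumann_algebra hull X)"
  unfolding hull_def
  using assms von_neumann_algebra_bounded_operators
  by (intro von_neumann_algebra_Inter) auto


section \<open>Group von Neumann algebras\<close>

class group_mult = monoid_mult + inverse +
  assumes group_left_inverse: "inverse a * a = 1"
begin

lemma group_right_inverse: "a * inverse a = 1"
proof -
  have "a * inverse a = (inverse (inverse a) * inverse a) * (a * inverse a)"
    by (simp add: group_left_inverse)
  also have "\<dots> = inverse (inverse a) * ((inverse a * a) * inverse a)"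
    by (simp only: mult.assoc)
  finally show ?thesis by (simp add: group_left_inverse)
qed

lemma group_inverse_mult_cancel:
  "inverse a * (a * b) = b" "a * (inverse a * b) = b"
  by (simp_all add: mult.assoc[symmetric] group_left_inverse group_right_inverse)

end

lemma bij_group_mult: "bij (\<lambda>h. g * h)" for g :: "'g::group_mult"
  by (rule bij_betw_byWitness[where f' = "\<lambda>h. inverse g * h"])
    (auto simp: group_inverse_mult_cancel)

text \<open>The inverse makes $u_g \delta_h = \delta_{gh}$, see \<open>left_reg_delta\<close> below.\<close>

lift_definition left_translate :: "'g::group_mult \<Rightarrow> 'g ell2 \<Rightarrow> 'g ell2"
  is "\<lambda>g f h. f (inverse g * h)"
  unfolding square_summable_def
  by (subst summable_on_reindex_bij_betw[OF bij_group_mult])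

lemma norm_left_translate: "norm (left_translate g f) = norm f"
proof -
  have "(norm (left_translate g f))\<^sup>2 = (norm f)\<^sup>2"
    unfolding norm_ell2_sq left_translate.rep_eq
    by (rule infsum_reindex_bij_betw[OF bij_group_mult])
  then show ?thesis by simp
qed

lift_definition left_reg :: "'g::group_mult \<Rightarrow> 'g ell2 \<Rightarrow>\<^sub>L 'g ell2" is left_translate
proof (rule bounded_linear_intro)
  fix g :: 'g and f k :: "'g ell2" and r :: real
  show "left_translate g (f + k) = left_translate g f + left_translate g k"
    by (rule ell2_eqI) (simp add: left_translate.rep_eq plus_ell2.rep_eq)
  show "left_translate g (r *\<^sub>R f) = r *\<^sub>R left_translate g f"
    by (rule ell2_eqI) (simp add: scaleR_ell2_def left_translate.rep_eq scaleC_ell2.rep_eq)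
  show "norm (left_translate g f) \<le> norm f * 1"
    by (simp add: norm_left_translate)
qed

lemma left_reg_delta: "left_reg g (delta h) = delta (g * h)"
proof (rule ell2_eqI)
  fix k
  have "inverse g * k = h \<longleftrightarrow> k = g * h"
    using group_inverse_mult_cancel by metis
  then show "ell2_apply (left_reg g (delta h)) k = ell2_apply (delta (g * h)) k"
    by (simp add: left_reg.rep_eq left_translate.rep_eq delta.rep_eq)
qed

lemma left_reg_in_bounded_operators: "left_reg g \<in> bounded_operators"
  unfolding bounded_operators_def
  by (auto intro!: ell2_eqI simp: left_reg.rep_eq left_translate.rep_eq scaleC_ell2.rep_eq)

text \<open>
  For a subgroup $H$ of $G$, this is $L(H)$ inside $L(G)$; in particular \<open>group_vN UNIV\<close> is $L(G)$.
\<close>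

definition group_vN :: "'g::group_mult set \<Rightarrow> ('g ell2 \<Rightarrow>\<^sub>L 'g ell2) set" where
  "group_vN H = von_neumann_algebra hull (left_reg ` H)"

definition invariant_subalgebra :: "('g::group_mult ell2 \<Rightarrow>\<^sub>L 'g ell2) set \<Rightarrow> bool" where
  "invariant_subalgebra P \<longleftrightarrow>
     von_neumann_algebra P \<and> P \<subseteq> group_vN UNIV \<and>
     (\<forall>g. (\<lambda>T. left_reg g o\<^sub>L T o\<^sub>L adjoint_op (left_reg g)) ` P = P)"

lemma von_neumann_algebra_group_vN: "von_neumann_algebra (group_vN H)"
  unfolding group_vN_def
  by (rule von_neumann_algebra_hull) (auto simp: left_reg_in_bounded_operators)


section \<open>The finitary symmetric and alternating groups\<close>

instance perm :: (type) group_mult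
  by standard (rule perm.left_inverse)

typedef pos_nat = "{n :: nat. 1 \<le> n}"
  by blast

text \<open>The type \<open>'a perm\<close> consists of the bijections with finite support only.\<close>

type_synonym S_N = "pos_nat perm"

definition A_N :: "S_N set" where
  "A_N = {s. evenperm (Perm.apply s)}"

end

theory Submission
  imports Defs
begin

text \<open>
  Elements of $L(G)$ commute with right translations, so $T$ is determined by its coefficients
  $T_g = (T\delta_1)(g)$.  Since $P$ is invariant, averaging $u_s T u_s^*$ over permutations $s$ that
  fix a finite set $F$ pointwise and move another finite set to many disjoint places shows that
  truncating the coefficients of $T \in P$ to the permutations supported in $F$ gives an element
  of $P$.

  If $T \in P$ has $T_g \neq 0$ with $g \neq 1$, truncate $T$ to the support $F$ of $g$, getting $p$.
  Take $i = g(j) \neq j$ and $k \neq l$ outside $F$, and let $p_k$, $p_l$ be the conjugates of $p$ by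
  the transpositions $(i\,k)$, $(i\,l)$.  Then $p_k^* p_l \in P$ has at the three-cycle
  $c = (j\,l)(l\,k)$ the coefficient $\sum_{x(j) = i} |p_x|^2 > 0$ and at $c^{-1}$ the coefficient $0$.
  Truncating to $\{j, k, l\}$ puts a transposition or $c$ into $P$.  In the first case $P = L(S)$.
  In the second $L(A) \subseteq P$, and a nonzero coefficient at an odd permutation can be moved to a
  transposition by multiplying with an even one.
\<close>

unbundle permutation_syntax

subsection \<open>Operators commuting with right translations\<close>

lemma limitin_strong_operator_topology:
  "limitin strong_operator_topology A T F \<longleftrightarrow> (\<forall>f. ((\<lambda>n. blinfun_apply (A n) f) \<longlongrightarrow> T f) F)"
proof
  assume "limitin strong_operator_topology A T F"
  then show "\<forall>f. ((\<lambda>n. blinfun_apply (A n) f) \<longlongrightarrow> T f) F"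
    using continuous_map_limit[OF strong_operator_topology_continuous_evaluation]
    by (fastforce simp: o_def)
next
  assume *: "\<forall>f. ((\<lambda>n. blinfun_apply (A n) f) \<longlongrightarrow> T f) F"
  show "limitin strong_operator_topology A T F"
    unfolding limitin_def
  proof (intro conjI allI impI)
    show "T \<in> topspace strong_operator_topology"
      by (simp add: strong_operator_topology_topspace)
    fix U assume U: "openin strong_operator_topology U \<and> T \<in> U"
    \<comment> \<open>The topology is pulled back along \<open>blinfun_apply\<close> from the
      product topology, where limits are componentwise.\<close>
    then obtain V where V: "open V" "U = blinfun_apply -` V"
      unfolding strong_operator_topology_def openin_pullback_topology by auto
    have "limitin (product_topology (\<lambda>_. euclidean) UNIV) (\<lambda>n. blinfun_apply (A n)) T F"
      using * by (simp add: limitin_componentwise)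
    then have "limitin euclidean (\<lambda>n. blinfun_apply (A n)) T F"
      by (simp add: euclidean_product_topology)
    with U V show "\<forall>\<^sub>F n in F. A n \<in> U"
      by (simp add: limitin_def)
  qed
qed

text \<open>Strong closedness enters through this form. The filter is arbitrary because both
  sequences of averages and the net of finite sets of points occur below.\<close>

lemma von_neumann_algebra_limit:
  assumes "von_neumann_algebra M" "\<And>f. ((\<lambda>n. blinfun_apply (A n) f) \<longlongrightarrow> blinfun_apply T f) F"
    "\<forall>\<^sub>F n in F. A n \<in> M" "F \<noteq> bot"
  shows "T \<in> M"
  using assms limitin_closedin[of strong_operator_topology A T F M]
  by (simp add: limitin_strong_operator_topology von_neumann_algebra_def)

lemma scaleC_simps [simp]:
  "scaleC_ell2 1 f = f" "scaleC_ell2 0 f = 0" "scaleC_ell2 c 0 = 0" "scaleC_ell2 (-1) f = - f"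
  by (auto intro!: ell2_eqI simp: scaleC_ell2.rep_eq zero_ell2.rep_eq uminus_ell2.rep_eq)

context
  fixes M :: "('g ell2 \<Rightarrow>\<^sub>L 'g ell2) set"
  assumes M: "von_neumann_algebra M"
begin

lemma vN_id: "id_blinfun \<in> M"
  and vN_add: "S \<in> M \<Longrightarrow> T \<in> M \<Longrightarrow> S + T \<in> M"
  and vN_comp: "S \<in> M \<Longrightarrow> T \<in> M \<Longrightarrow> S o\<^sub>L T \<in> M"
  and vN_scale: "T \<in> M \<Longrightarrow> scalar_op c o\<^sub>L T \<in> M"
  and vN_adjoint: "T \<in> M \<Longrightarrow> adjoint_op T \<in> M"
  using M unfolding von_neumann_algebra_def by blast+

lemma vN_scalar: "scalar_op c \<in> M"
proof -
  have "scalar_op c o\<^sub>L id_blinfun = (scalar_op c :: 'g ell2 \<Rightarrow>\<^sub>L 'g ell2)"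
    by (rule blinfun_eqI) simp
  then show ?thesis
    using vN_scale[OF vN_id, of c] by simp
qed

lemma vN_zero: "0 \<in> M"
proof -
  have "scalar_op 0 = (0 :: 'g ell2 \<Rightarrow>\<^sub>L 'g ell2)"
    by (rule blinfun_eqI) (simp add: scalar_op.rep_eq)
  then show ?thesis
    using vN_scalar[of 0] by simp
qed

lemma vN_sum: "(\<And>x. x \<in> X \<Longrightarrow> A x \<in> M) \<Longrightarrow> sum A X \<in> M"
  by (induction X rule: infinite_finite_induct) (auto simp: vN_zero vN_add)

lemma vN_diff: "S \<in> M \<Longrightarrow> T \<in> M \<Longrightarrow> S - T \<in> M"
proof -
  assume *: "S \<in> M" "T \<in> M"
  have "S - T = S + (scalar_op (-1) o\<^sub>L T)"
    by (rule blinfun_eqI) (simp add: scalar_op.rep_eq blinfun.add_left blinfun.diff_left)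
  then show ?thesis
    using * by (simp only: vN_add vN_scale)
qed

end

section \<open>Adjoints and the left regular representation\<close>

lemma adjoint_op_unique:
  assumes "T \<in> bounded_operators" "\<And>f g. cinner_ell2 (blinfun_apply S f) g = cinner_ell2 f (T g)"
  shows "adjoint_op T = S"
  by (intro blinfun_eqI cinner_eqI) (simp add: assms cinner_adjoint_op)

lemma cinner_adjoint_op_right:
  assumes "T \<in> bounded_operators"
  shows "cinner_ell2 f (adjoint_op T g) = cinner_ell2 (T f) g"
  by (metis assms cinner_adjoint_op cinner_commute)

lemma inverse_one_group: "inverse 1 = (1 :: 'g::group_mult)"
  by (metis group_left_inverse mult_1_right)

lemma group_left_cancel: "a * b = a * c \<longleftrightarrow> b = c" for a b c :: "'g::group_mult"
  by (metis group_inverse_mult_cancel(1))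

lemma inverse_inverse_group: "inverse (inverse g) = g" for g :: "'g::group_mult"
  by (metis group_left_cancel group_left_inverse group_right_inverse)

lemma inverse_mult_group: "inverse (g * h) = inverse h * inverse g" for g h :: "'g::group_mult"
proof -
  have "(g * h) * (inverse h * inverse g) = 1"
    by (simp add: mult.assoc group_inverse_mult_cancel group_right_inverse)
  then show ?thesis
    by (metis group_left_cancel group_right_inverse)
qed

lemma left_reg_apply: "ell2_apply (left_reg g f) h = ell2_apply f (inverse g * h)"
  by (simp add: left_reg.rep_eq left_translate.rep_eq)

lemma cinner_left_reg: "cinner_ell2 (left_reg (inverse g) f) k = cinner_ell2 f (left_reg g k)"
  unfolding cinner_ell2_def left_reg_apply inverse_inverse_group
  by (subst infsum_reindex_bij_betw[OF bij_group_mult[of g], symmetric])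
    (simp add: group_inverse_mult_cancel)

lemma adjoint_left_reg: "adjoint_op (left_reg g) = left_reg (inverse g)"
  by (rule adjoint_op_unique) (simp_all add: left_reg_in_bounded_operators cinner_left_reg)

lemma left_reg_mult: "left_reg (g * h) = left_reg g o\<^sub>L left_reg h"
  by (intro blinfun_eqI ell2_eqI) (simp add: left_reg_apply inverse_mult_group mult.assoc)

lemma left_reg_one: "left_reg 1 = id_blinfun"
  by (intro blinfun_eqI ell2_eqI) (simp add: left_reg_apply inverse_one_group)

lemma norm_left_reg_apply: "norm (left_reg g f) = norm f"
  by (simp add: left_reg.rep_eq norm_left_translate)

section \<open>Right translations and their commutant\<close>

lemma bij_group_mult_right: "bij (\<lambda>h. h * k)" for k :: "'g::group_mult"
  by (rule bij_betw_byWitness[where f' = "\<lambda>h. h * inverse k"])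
    (auto simp: mult.assoc group_left_inverse group_right_inverse)

lift_definition right_translate :: "'g::group_mult \<Rightarrow> 'g ell2 \<Rightarrow> 'g ell2"
  is "\<lambda>k f h. f (h * k)"
  unfolding square_summable_def
  by (subst summable_on_reindex_bij_betw[OF bij_group_mult_right])

lemma norm_right_translate: "norm (right_translate k f) = norm f"
proof -
  have "(norm (right_translate k f))\<^sup>2 = (norm f)\<^sup>2"
    unfolding norm_ell2_sq right_translate.rep_eq
    by (rule infsum_reindex_bij_betw[OF bij_group_mult_right])
  then show ?thesis by simp
qed

lemma right_translate_linear:
  "right_translate k (f + g) = right_translate k f + right_translate k g"
  "right_translate k (scaleC_ell2 c f) = scaleC_ell2 c (right_translate k f)"
  by (auto intro!: ell2_eqI
      simp: right_translate.rep_eq plus_ell2.rep_eq scaleC_ell2.rep_eq)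

lemma bounded_linear_right_translate: "bounded_linear (right_translate k)"
  by (rule bounded_linear_intro[where K = 1])
    (simp_all add: right_translate_linear scaleR_ell2_def norm_right_translate)

lemma right_translate_delta: "right_translate k (delta h) = delta (h * inverse k)"
  by (rule ell2_eqI)
    (auto simp: right_translate.rep_eq delta.rep_eq mult.assoc group_left_inverse group_right_inverse)

lemma cinner_right_translate:
  "cinner_ell2 (right_translate (inverse k) f) g = cinner_ell2 f (right_translate k g)"
  unfolding cinner_ell2_def right_translate.rep_eq
  by (subst infsum_reindex_bij_betw[OF bij_group_mult_right[of k], symmetric])
    (simp add: mult.assoc group_right_inverse)

text \<open>The commutant of the right translations. It contains L(G), and membership is a condition
  on vectors, which is easier to apply than the hull defining \<open>group_vN\<close>.\<close>

definition right_invariant :: "('g::group_mult ell2 \<Rightarrow>\<^sub>L 'g ell2) set" where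
  "right_invariant = {T \<in> bounded_operators. \<forall>k f. T (right_translate k f) = right_translate k (T f)}"

lemma von_neumann_algebra_right_invariant: "von_neumann_algebra right_invariant"
  unfolding von_neumann_algebra_def
proof (intro conjI ballI allI)
  note B = von_neumann_algebra_bounded_operators
  show "right_invariant \<subseteq> bounded_operators" "id_blinfun \<in> right_invariant"
    by (auto simp: right_invariant_def vN_id[OF B])
  fix S T :: "'a ell2 \<Rightarrow>\<^sub>L 'a ell2" and c assume S: "S \<in> right_invariant" and T: "T \<in> right_invariant"
  show "S + T \<in> right_invariant" "S o\<^sub>L T \<in> right_invariant" "scalar_op c o\<^sub>L T \<in> right_invariant"
    using S T
    by (auto simp: right_invariant_def vN_add[OF B] vN_comp[OF B] vN_scale[OF B] scalar_op.rep_eq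
        blinfun.add_left right_translate_linear)
  have T': "T \<in> bounded_operators" "T (right_translate k f) = right_translate k (T f)" for k f
    using T by (auto simp: right_invariant_def)
  \<comment> \<open>The adjoint of a right translation is the inverse one, so commuting with all
    translations passes to the adjoint.\<close>
  have "adjoint_op T (right_translate k f) = right_translate k (adjoint_op T f)" for k f
  proof (rule cinner_eqI)
    fix g
    show "cinner_ell2 (adjoint_op T (right_translate k f)) g
        = cinner_ell2 (right_translate k (adjoint_op T f)) g"
      using cinner_right_translate[of "inverse k"] T'
      by (simp add: cinner_adjoint_op inverse_inverse_group)
  qed
  then show "adjoint_op T \<in> right_invariant"
    by (simp add: right_invariant_def T' adjoint_op_in_bounded_operators)
next
  show "closedin strong_operator_topology (right_invariant :: ('a ell2 \<Rightarrow>\<^sub>L 'a ell2) set)"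
  proof -
    \<comment> \<open>Each commutation condition cuts out the zero set of a strongly continuous map,
      so the commutant is an intersection of closed sets.\<close>
    have cont: "continuous_map strong_operator_topology euclidean
        (\<lambda>T :: 'a ell2 \<Rightarrow>\<^sub>L 'a ell2. T (right_translate k f) - right_translate k (T f))" for k f
    proof (intro continuous_map_diff strong_operator_topology_continuous_evaluation)
      show "continuous_map strong_operator_topology euclidean
          (\<lambda>T :: 'a ell2 \<Rightarrow>\<^sub>L 'a ell2. right_translate k (T f))"
        using continuous_map_compose[OF strong_operator_topology_continuous_evaluation[of f],
            of euclidean "right_translate k"]
        by (simp add: o_def linear_continuous_on bounded_linear_right_translate)
    qed
    have "closedin strong_operator_topology
        (bounded_operators \<inter> (\<Inter>(k, f). {T \<in> topspace strong_operator_topology.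
          blinfun_apply T (right_translate k f) - right_translate k (T f) \<in> {0 :: 'a ell2}}))"
      using closedin_continuous_map_preimage[OF cont, of "{0}"]
      by (intro closedin_Int closedin_bounded_operators closedin_INT) auto
    also have "\<dots> = right_invariant"
      by (auto simp: right_invariant_def strong_operator_topology_topspace)
    finally show ?thesis .
  qed
qed

lemma left_reg_right_invariant: "left_reg g \<in> right_invariant"
  by (auto simp: right_invariant_def left_reg_in_bounded_operators left_reg_apply
      right_translate.rep_eq mult.assoc intro!: ell2_eqI)

lemma group_vN_right_invariant: "group_vN H \<subseteq> right_invariant"
  unfolding group_vN_def
  by (rule hull_minimal) (auto simp: left_reg_right_invariant von_neumann_algebra_right_invariant)

subsection \<open>Coefficients\<close>

text \<open>The Fourier coefficients: an element of L(G) has the formal expansion sum over g of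
  \<open>op_coeff T g\<close> times u_g.\<close>

definition op_coeff :: "('g::group_mult ell2 \<Rightarrow>\<^sub>L 'g ell2) \<Rightarrow> 'g \<Rightarrow> complex" where
  "op_coeff T = ell2_apply (T (delta 1))"

text \<open>A right translation carries delta_1 to delta_g, and \<open>T\<close> commutes with it.
  This is why the single vector T delta_1 determines \<open>T\<close>.\<close>

lemma right_invariant_delta:
  assumes "T \<in> right_invariant"
  shows "T (delta g) = right_translate (inverse g) (T (delta 1))"
proof -
  have "delta g = right_translate (inverse g) (delta 1)"
    by (simp add: right_translate_delta inverse_inverse_group)
  then show ?thesis
    using assms by (auto simp: right_invariant_def)
qed

lemma bounded_operators_truncate:
  assumes "T \<in> bounded_operators"
  shows "T (truncate A f) = (\<Sum>h\<in>A. scaleC_ell2 (ell2_apply f h) (T (delta h)))"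
  using assms by (simp add: truncate_def blinfun.sum_right bounded_operators_def)

text \<open>Right translations carry convergence from delta_1 to every delta_h, linearity to
  finitely supported vectors, and the uniform norm bound to all vectors by density.\<close>

lemma right_invariant_tendsto:
  assumes A: "\<And>n. A n \<in> right_invariant" and T: "T \<in> right_invariant"
    and bound: "\<forall>\<^sub>F n in F. norm (A n) \<le> C"
    and lim: "((\<lambda>n. blinfun_apply (A n) (delta 1)) \<longlongrightarrow> blinfun_apply T (delta 1)) F"
  shows "((\<lambda>n. blinfun_apply (A n) f) \<longlongrightarrow> T f) F"
proof (rule tendstoI)
  fix e :: real assume e: "e > 0"
  have bl: "A n \<in> bounded_operators" "T \<in> bounded_operators" for n
    using A T by (auto simp: right_invariant_def)
  have lim_delta: "((\<lambda>n. blinfun_apply (A n) (delta h)) \<longlongrightarrow> T (delta h)) F" for h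
    unfolding right_invariant_delta[OF A, of _ h] right_invariant_delta[OF T, of h]
    by (rule bounded_linear.tendsto[OF bounded_linear_right_translate lim])
  have lim_trunc: "((\<lambda>n. blinfun_apply (A n) (truncate B f)) \<longlongrightarrow> T (truncate B f)) F" for B
    unfolding bounded_operators_truncate[OF bl(1)] bounded_operators_truncate[OF bl(2)]
      scalar_op.rep_eq[symmetric]
    by (intro tendsto_sum bounded_linear.tendsto[OF blinfun.bounded_linear_right] lim_delta)
  \<comment> \<open>\<open>K\<close> dominates the sum of the norms of \<open>A n\<close> and
    \<open>T\<close> wherever the bound holds; the summand 1 makes it positive, so that one can
    divide by it.\<close>
  define K where "K = \<bar>C\<bar> + norm T + 1"
  have K: "K > 0" by (simp add: K_def add_nonneg_pos)
  have "\<forall>\<^sub>F B in finite_subsets_at_top UNIV. dist (truncate B f) f < e / (2 * K)"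
    using e K by (intro tendstoD[OF truncate_tendsto]) simp
  then obtain B where B: "norm (f - truncate B f) < e / (2 * K)"
    by (auto simp: dist_norm norm_minus_commute
        dest: eventually_happens'[OF finite_subsets_at_top_neq_bot])
  have "\<forall>\<^sub>F n in F. dist (A n (truncate B f)) (T (truncate B f)) < e / 2"
    using e by (intro tendstoD[OF lim_trunc]) simp
  with bound show "\<forall>\<^sub>F n in F. dist (A n f) (T f) < e"
  proof eventually_elim
    case (elim n)
    let ?d = "f - truncate B f"
    have "A n f - T f = (A n (truncate B f) - T (truncate B f)) + (A n ?d - T ?d)"
      by (simp add: blinfun.diff_right)
    then have "norm (A n f - T f)
        \<le> norm (A n (truncate B f) - T (truncate B f)) + norm (A n ?d - T ?d)"
      by (metis norm_triangle_ineq)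
    also have "norm (A n ?d - T ?d) \<le> norm (A n ?d) + norm (T ?d)"
      by (rule norm_triangle_ineq4)
    also have "norm (A n ?d) + norm (T ?d) \<le> C * norm ?d + norm T * norm ?d"
      using elim(1)
      by (intro add_mono norm_blinfun order_trans[OF norm_blinfun] mult_right_mono) auto
    also have "\<dots> \<le> K * norm ?d"
      unfolding distrib_right[symmetric] by (rule mult_right_mono) (auto simp: K_def)
    also have "K * norm ?d < e / 2"
      using B K by (simp add: field_simps)
    finally show ?case
      using elim by (simp add: dist_norm)
  qed
qed

text \<open>The vector delta_1 is separating: the constant sequence \<open>S\<close> converges to
  \<open>T\<close> on delta_1, hence on every vector.\<close>

lemma right_invariant_eqI:
  assumes "S \<in> right_invariant" "T \<in> right_invariant" "op_coeff S = op_coeff T"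
  shows "S = T"
proof (rule blinfun_eqI)
  fix f
  have "S (delta 1) = T (delta 1)"
    using assms(3) by (intro ell2_eqI) (simp add: op_coeff_def)
  then have lim: "(\<lambda>n. S (delta 1)) \<longlonglongrightarrow> T (delta 1)"
    by simp
  have "(\<lambda>n. S f) \<longlonglongrightarrow> T f"
    by (rule right_invariant_tendsto[OF assms(1,2) always_eventually lim, where C = "norm S"]) simp
  then show "S f = T f"
    by (simp add: LIMSEQ_const_iff)
qed

lemma op_coeff_left_reg: "op_coeff (left_reg g) h = (if h = g then 1 else 0)"
  by (simp add: op_coeff_def left_reg_delta delta.rep_eq)

lemma op_coeff_comp_left_reg:
  assumes "T \<in> right_invariant"
  shows "op_coeff (T o\<^sub>L left_reg g) h = op_coeff T (h * inverse g)"
  by (simp add: op_coeff_def left_reg_delta right_invariant_delta[OF assms, of g]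
      right_translate.rep_eq)

lemma op_coeff_conj:
  assumes "T \<in> right_invariant"
  shows "op_coeff (left_reg g o\<^sub>L T o\<^sub>L adjoint_op (left_reg g)) h = op_coeff T (inverse g * h * g)"
  by (simp add: op_coeff_def adjoint_left_reg left_reg_apply left_reg_delta
      right_invariant_delta[OF assms, of "inverse g"] right_translate.rep_eq inverse_inverse_group
      mult.assoc)

lemma right_invariant_scalarI:
  assumes "T \<in> right_invariant" "\<And>g. g \<noteq> 1 \<Longrightarrow> op_coeff T g = 0"
  shows "T = scalar_op (op_coeff T 1)"
proof (rule right_invariant_eqI)
  show "op_coeff T = op_coeff (scalar_op (op_coeff T 1))"
    using assms(2)
    by (auto simp: fun_eq_iff op_coeff_def scalar_op.rep_eq scaleC_ell2.rep_eq delta.rep_eq)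
qed (use assms vN_scalar[OF von_neumann_algebra_right_invariant] in auto)

text \<open>A partial sum of the Fourier expansion. When \<open>X\<close> is a finite subgroup and
  \<open>T\<close> lies in L(G), it is the conditional expectation of \<open>T\<close> onto
  L(X).\<close>

definition finite_part :: "'g set \<Rightarrow> ('g::group_mult ell2 \<Rightarrow>\<^sub>L 'g ell2) \<Rightarrow> ('g ell2 \<Rightarrow>\<^sub>L 'g ell2)" where
  "finite_part X T = (\<Sum>g\<in>X. scalar_op (op_coeff T g) o\<^sub>L left_reg g)"

lemma finite_part_delta: "finite_part X T (delta 1) = truncate X (T (delta 1))"
  by (simp add: finite_part_def truncate_def blinfun.sum_left scalar_op.rep_eq left_reg_delta
      op_coeff_def)

lemma op_coeff_finite_part:
  "finite X \<Longrightarrow> op_coeff (finite_part X T) g = (if g \<in> X then op_coeff T g else 0)"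
  by (simp add: op_coeff_def finite_part_delta truncate_apply)

text \<open>Terms with coefficient 0 vanish, so the lemma also applies to operators whose
  coefficients live on a subgroup such as the alternating group.\<close>

lemma finite_part_in:
  assumes "von_neumann_algebra M" "\<And>g. g \<in> X \<Longrightarrow> op_coeff T g \<noteq> 0 \<Longrightarrow> left_reg g \<in> M"
  shows "finite_part X T \<in> M"
  unfolding finite_part_def
proof (rule vN_sum[OF assms(1)])
  fix g assume "g \<in> X"
  have "scalar_op 0 o\<^sub>L left_reg g = 0"
    by (rule blinfun_eqI) (simp add: scalar_op.rep_eq)
  then show "scalar_op (op_coeff T g) o\<^sub>L left_reg g \<in> M"
    using assms \<open>g \<in> X\<close> by (cases "op_coeff T g = 0") (auto simp: vN_scale vN_zero)
qed

lemma finite_part_right_invariant: "finite_part X T \<in> right_invariant"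
  by (rule finite_part_in) (rule von_neumann_algebra_right_invariant left_reg_right_invariant)+

subsection \<open>Finitely supported permutations\<close>

lemma perm_extends_inj:
  assumes "finite A" "inj_on f A"
  obtains s :: "'a perm" where "\<And>x. x \<in> A \<Longrightarrow> s \<langle>$\<rangle> x = f x"
proof -
  have "\<exists>s :: 'a perm. \<forall>x\<in>A. s \<langle>$\<rangle> x = f x"
    using assms
  proof (induction A rule: finite_induct)
    case (insert a A)
    then obtain s :: "'a perm" where s: "\<forall>x\<in>A. s \<langle>$\<rangle> x = f x"
      by auto
    \<comment> \<open>The swap corrects the value at the new point \<open>a\<close>. At an old point
      x the value f x differs from both s a and f a, so it is kept.\<close>
    have "(\<langle>s \<langle>$\<rangle> a \<leftrightarrow> f a\<rangle> * s) \<langle>$\<rangle> x = f x" if "x \<in> insert a A" for x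
    proof (cases "x = a")
      case True
      then show ?thesis by (simp add: apply_times)
    next
      case False
      then have "s \<langle>$\<rangle> x \<noteq> s \<langle>$\<rangle> a" "s \<langle>$\<rangle> x = f x" "f x \<noteq> f a"
        using that s insert.prems insert.hyps by (auto simp: apply_inj rev_image_eqI)
      then show ?thesis by (simp add: apply_times)
    qed
    then show ?case by blast
  qed simp
  then show ?thesis using that by blast
qed

lemma perm_inverse_apply [simp]:
  "inverse s \<langle>$\<rangle> (s \<langle>$\<rangle> x) = x" "s \<langle>$\<rangle> (inverse s \<langle>$\<rangle> x) = x"
  by (simp_all add: apply_sequence)

lemma affected_conj: "affected (s * h * inverse s) = apply s ` affected h"
proof (intro set_eqI)
  fix x
  obtain y where "x = s \<langle>$\<rangle> y"
    using perm_inverse_apply(2) by metis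
  then show "x \<in> affected (s * h * inverse s) \<longleftrightarrow> x \<in> apply s ` affected h"
    by (auto simp: in_affected apply_times apply_inj)
qed

definition supported_perms :: "'a set \<Rightarrow> 'a perm set" where
  "supported_perms F = {s. affected s \<subseteq> F}"

lemma finite_supported_perms:
  assumes "finite F"
  shows "finite (supported_perms F)"
proof (rule finite_imageD)
  have "apply ` supported_perms F \<subseteq> {p. p permutes F}"
    using bij_apply by (fastforce simp: supported_perms_def in_affected permutes_def bij_iff[symmetric])
  then show "finite (apply ` supported_perms F)"
    using assms finite_permutations finite_subset by blast
  show "inj_on apply (supported_perms F)"
    by (auto intro!: inj_onI perm_eqI)
qed

lemma supported_perms_conj:
  assumes "\<And>x. x \<in> F \<Longrightarrow> s \<langle>$\<rangle> x = x" "h \<in> supported_perms F"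
  shows "s * h * inverse s = h"
proof -
  have "affected s \<inter> affected h = {}"
    using assms by (auto simp: supported_perms_def in_affected)
  then have "s * h = h * s"
    using perm_mult_commute by metis
  then show ?thesis
    by (simp add: mult.assoc)
qed

text \<open>The permutations fix \<open>F\<close> and send the rest of \<open>G\<close> to pairwise
  disjoint places. An element supported in \<open>G\<close> but not in \<open>F\<close> thus gets
  conjugates with different supports, which later makes averaging kill its coefficient.\<close>

lemma perms_spreading:
  assumes "infinite (UNIV :: 'a set)" "finite F" "finite G"
  obtains s :: "nat \<Rightarrow> 'a perm"
  where "\<And>j x. x \<in> F \<Longrightarrow> s j \<langle>$\<rangle> x = x"
    and "\<And>i j g h. i \<noteq> j \<Longrightarrow> g \<in> supported_perms G - supported_perms F \<Longrightarrow>
      h \<in> supported_perms G - supported_perms F \<Longrightarrow>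
      s i * g * inverse (s i) \<noteq> s j * h * inverse (s j)"
proof -
  have "infinite (- F)"
    using assms by (metis finite_compl)
  then obtain \<iota> :: "nat \<Rightarrow> 'a" where \<iota>: "inj \<iota>" "range \<iota> \<subseteq> - F"
    using infinite_countable_subset by blast
  obtain e :: "'a \<Rightarrow> nat" where e: "inj_on e G"
    using finite_imp_inj_to_nat_seg[OF assms(3)] by blast
  \<comment> \<open>\<open>prod_encode (j, e x)\<close> numbers the pairs of an index and a point,
    so each copy of G - F receives its own fresh points outside \<open>F\<close>.\<close>
  define f where "f j x = (if x \<in> F then x else \<iota> (prod_encode (j, e x)))" for j x
  have \<iota>F: "\<iota> n \<notin> F" for n
    using \<iota> by auto
  have f_eq: "f i x = f j y \<longleftrightarrow> x = y \<and> (x \<in> F \<or> i = j)" if "x \<in> F \<union> G" "y \<in> F \<union> G" for i j x y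
    using that \<iota>F[of "prod_encode (i, e x)"] \<iota>F[of "prod_encode (j, e y)"] e
    by (auto simp: f_def inj_eq[OF \<iota>(1)] inj_eq[OF inj_prod_encode] inj_on_eq_iff)
  then have "inj_on (f j) (F \<union> G)" for j
    by (auto intro!: inj_onI)
  then have "\<exists>s :: 'a perm. \<forall>x\<in>F \<union> G. s \<langle>$\<rangle> x = f j x" for j
    using perm_extends_inj[of "F \<union> G" "f j"] assms by (metis finite_UnI)
  then obtain s :: "nat \<Rightarrow> 'a perm" where s: "\<And>j x. x \<in> F \<union> G \<Longrightarrow> s j \<langle>$\<rangle> x = f j x"
    by metis
  show thesis
  proof
    fix j x assume "x \<in> F"
    then show "s j \<langle>$\<rangle> x = x"
      by (simp add: s f_def)
  next
    fix i j :: nat and g h assume ij: "i \<noteq> j" and gh: "g \<in> supported_perms G - supported_perms F"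
      "h \<in> supported_perms G - supported_perms F"
    \<comment> \<open>A point x of G - F moved by \<open>g\<close> goes under \<open>s i\<close> to
      a place that \<open>s j\<close> does not reach from \<open>G\<close>, so the two conjugates
      differ in support.\<close>
    then obtain x where x: "x \<in> affected g" "x \<in> G" "x \<notin> F"
      by (auto simp: supported_perms_def)
    show "s i * g * inverse (s i) \<noteq> s j * h * inverse (s j)"
    proof
      assume "s i * g * inverse (s i) = s j * h * inverse (s j)"
      then have "apply (s i) ` affected g = apply (s j) ` affected h"
        by (metis affected_conj)
      then obtain y where "y \<in> affected h" "s i \<langle>$\<rangle> x = s j \<langle>$\<rangle> y"
        using x by blast
      then have "f i x = f j y" "y \<in> G"
        using x gh by (auto simp: s supported_perms_def subset_iff)
      then show False
        using f_eq[of x y i j] x ij by auto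
    qed
  qed
qed

section \<open>Permutations supported in a given set, with the cases of two and three points\<close>

lemma mem_supported_perms: "s \<in> supported_perms F \<longleftrightarrow> affected s \<subseteq> F"
  by (simp add: supported_perms_def)

lemma supported_perms_fixed: "s \<in> supported_perms F \<Longrightarrow> x \<notin> F \<Longrightarrow> s \<langle>$\<rangle> x = x"
  by (metis in_affected mem_Collect_eq subsetD supported_perms_def)

lemma perm_eq_onI:
  assumes "s \<in> supported_perms F" "t \<in> supported_perms F"
    "\<And>x. x \<in> F \<Longrightarrow> s \<langle>$\<rangle> x = t \<langle>$\<rangle> x"
  shows "s = t"
proof (rule perm_eqI)
  fix x
  show "s \<langle>$\<rangle> x = t \<langle>$\<rangle> x"
    using assms by (cases "x \<in> F") (simp_all add: supported_perms_fixed)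
qed

lemma supported_perms_apply_in:
  "s \<in> supported_perms F \<Longrightarrow> x \<in> F \<Longrightarrow> s \<langle>$\<rangle> x \<in> F"
  by (metis (mono_tags) apply_affected in_affected mem_Collect_eq subsetD supported_perms_def)

lemma supported_perms_mult:
  "s \<in> supported_perms F \<Longrightarrow> t \<in> supported_perms F \<Longrightarrow> s * t \<in> supported_perms F"
  unfolding supported_perms_def using affected_times[of s t] by blast

lemma supported_perms_swap: "a \<in> F \<Longrightarrow> b \<in> F \<Longrightarrow> \<langle>a \<leftrightarrow> b\<rangle> \<in> supported_perms F"
  by (cases "a = b") (auto simp: supported_perms_def affected_swap)

lemma one_in_supported_perms: "1 \<in> supported_perms F"
  by (simp add: supported_perms_def)

lemma supported_perms_pair: "supported_perms {a, b} = {1, \<langle>a \<leftrightarrow> b\<rangle>}"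
proof
  show "{1, \<langle>a \<leftrightarrow> b\<rangle>} \<subseteq> supported_perms {a, b}"
    by (simp add: one_in_supported_perms supported_perms_swap)
  show "supported_perms {a, b} \<subseteq> {1, \<langle>a \<leftrightarrow> b\<rangle>}"
  proof
    fix s assume s: "s \<in> supported_perms {a, b}"
    have "s \<langle>$\<rangle> a \<in> {a, b}" "s \<langle>$\<rangle> b \<in> {a, b}" "s \<langle>$\<rangle> a = s \<langle>$\<rangle> b \<longleftrightarrow> a = b"
      using supported_perms_apply_in[OF s] by (simp_all add: apply_inj)
    then consider "s \<langle>$\<rangle> a = a" "s \<langle>$\<rangle> b = b" | "s \<langle>$\<rangle> a = b" "s \<langle>$\<rangle> b = a"
      by auto
    then show "s \<in> {1, \<langle>a \<leftrightarrow> b\<rangle>}"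
    proof cases
      case 1
      then have "s = 1"
        by (intro perm_eq_onI[OF s one_in_supported_perms]) auto
      then show ?thesis by simp
    next
      case 2
      then have "s = \<langle>a \<leftrightarrow> b\<rangle>"
        by (intro perm_eq_onI[OF s supported_perms_swap]) auto
      then show ?thesis by simp
    qed
  qed
qed

text \<open>The last two elements are a three-cycle and its inverse. Once swaps and one of these
  cycles are excluded, only the identity and the other cycle remain.\<close>

lemma supported_perms_triple:
  assumes "distinct [a, b, c]" "s \<in> supported_perms {a, b, c}"
  shows "s \<in> {1, \<langle>a \<leftrightarrow> b\<rangle>, \<langle>b \<leftrightarrow> c\<rangle>, \<langle>a \<leftrightarrow> c\<rangle>, \<langle>a \<leftrightarrow> b\<rangle> * \<langle>b \<leftrightarrow> c\<rangle>, \<langle>b \<leftrightarrow> c\<rangle> * \<langle>a \<leftrightarrow> b\<rangle>}"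
proof -
  note mem = one_in_supported_perms supported_perms_swap supported_perms_mult
  have eq: "s = t" if "t \<in> supported_perms {a, b, c}" "s \<langle>$\<rangle> a = t \<langle>$\<rangle> a" "s \<langle>$\<rangle> b = t \<langle>$\<rangle> b"
    "s \<langle>$\<rangle> c = t \<langle>$\<rangle> c" for t
    using that by (intro perm_eq_onI[OF assms(2)]) auto
  have "s \<langle>$\<rangle> a \<in> {a, b, c}" "s \<langle>$\<rangle> b \<in> {a, b, c}" "s \<langle>$\<rangle> c \<in> {a, b, c}"
    using supported_perms_apply_in[OF assms(2)] by auto
  moreover have "s \<langle>$\<rangle> a \<noteq> s \<langle>$\<rangle> b" "s \<langle>$\<rangle> a \<noteq> s \<langle>$\<rangle> c" "s \<langle>$\<rangle> b \<noteq> s \<langle>$\<rangle> c"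
    using assms(1) by (simp_all add: apply_inj)
  ultimately consider
      "s \<langle>$\<rangle> a = a" "s \<langle>$\<rangle> b = b" "s \<langle>$\<rangle> c = c" | "s \<langle>$\<rangle> a = b" "s \<langle>$\<rangle> b = a" "s \<langle>$\<rangle> c = c"
    | "s \<langle>$\<rangle> a = a" "s \<langle>$\<rangle> b = c" "s \<langle>$\<rangle> c = b" | "s \<langle>$\<rangle> a = c" "s \<langle>$\<rangle> b = b" "s \<langle>$\<rangle> c = a"
    | "s \<langle>$\<rangle> a = b" "s \<langle>$\<rangle> b = c" "s \<langle>$\<rangle> c = a" | "s \<langle>$\<rangle> a = c" "s \<langle>$\<rangle> b = a" "s \<langle>$\<rangle> c = b"
    by (smt (verit) insert_iff empty_iff)
  then show ?thesis
  proof cases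
    case 1 then have "s = 1" using assms by (intro eq) (auto simp: mem)
    then show ?thesis by simp
  next
    case 2 then have "s = \<langle>a \<leftrightarrow> b\<rangle>" using assms by (intro eq) (auto simp: mem)
    then show ?thesis by simp
  next
    case 3 then have "s = \<langle>b \<leftrightarrow> c\<rangle>" using assms by (intro eq) (auto simp: mem)
    then show ?thesis by simp
  next
    case 4 then have "s = \<langle>a \<leftrightarrow> c\<rangle>" using assms by (intro eq) (auto simp: mem)
    then show ?thesis by simp
  next
    case 5 then have "s = \<langle>a \<leftrightarrow> b\<rangle> * \<langle>b \<leftrightarrow> c\<rangle>" using assms by (intro eq) (auto simp: mem apply_times)
    then show ?thesis by simp
  next
    case 6 then have "s = \<langle>b \<leftrightarrow> c\<rangle> * \<langle>a \<leftrightarrow> b\<rangle>" using assms by (intro eq) (auto simp: mem apply_times)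
    then show ?thesis by simp
  qed
qed

lemma swap_conj: "s * \<langle>a \<leftrightarrow> b\<rangle> * inverse s = \<langle>s \<langle>$\<rangle> a \<leftrightarrow> s \<langle>$\<rangle> b\<rangle>"
proof (rule perm_eqI)
  fix x
  obtain y where x: "x = s \<langle>$\<rangle> y"
    using perm_inverse_apply(2) by metis
  show "(s * \<langle>a \<leftrightarrow> b\<rangle> * inverse s) \<langle>$\<rangle> x = \<langle>s \<langle>$\<rangle> a \<leftrightarrow> s \<langle>$\<rangle> b\<rangle> \<langle>$\<rangle> x"
    by (cases "y = a"; cases "y = b") (simp_all add: x apply_times apply_inj)
qed

section \<open>Parity and generation of the alternating group by three-cycles\<close>

lemma permutation_apply: "permutation (apply s)"
  by (simp add: permutation flip: affected.rep_eq)

lemma evenperm_swap_mult: "a \<noteq> b \<Longrightarrow> evenperm (apply (\<langle>a \<leftrightarrow> b\<rangle> * s)) \<longleftrightarrow> \<not> evenperm (apply s)"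
  by (simp add: apply_times evenperm_comp permutation_apply swap.rep_eq evenperm_swap permutation_swap_id)

lemma perm_mult_inverse_cancel: "inverse s * (s * t) = t" "s * (inverse s * t) = t" for s :: "'a perm"
  by (simp_all add: group_inverse_mult_cancel)

lemma swap_mult_cancel: "\<langle>a \<leftrightarrow> b\<rangle> * (\<langle>a \<leftrightarrow> b\<rangle> * s) = s"
  by (simp flip: mult.assoc)

text \<open>An even permutation is a product of pairs of swaps, and each pair is a product of
  three-cycles or trivial. \<open>H\<close> will be the set of g with u_g in the algebra.\<close>

lemma even_perm_generated:
  assumes one: "1 \<in> H" and mult: "\<And>s t. s \<in> H \<Longrightarrow> t \<in> H \<Longrightarrow> s * t \<in> H"
    and cycles: "\<And>a b c. distinct [a, b, c] \<Longrightarrow> \<langle>a \<leftrightarrow> b\<rangle> * \<langle>b \<leftrightarrow> c\<rangle> \<in> H"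
    and even: "evenperm (apply s)"
  shows "s \<in> H"
proof -
  have swaps: "\<langle>a \<leftrightarrow> b\<rangle> * \<langle>c \<leftrightarrow> d\<rangle> \<in> H" if "a \<noteq> b" "c \<noteq> d" for a b c d
  proof -
    \<comment> \<open>Two swaps with a common point form a three-cycle, or cancel when a =
      d.\<close>
    have meet: "\<langle>a \<leftrightarrow> b\<rangle> * \<langle>b \<leftrightarrow> d\<rangle> \<in> H" if "a \<noteq> b" "b \<noteq> d" for a b d
      using that one cycles[of a b d] by (cases "a = d") (auto simp: swap_sym[of b d])
    show ?thesis
    proof (cases "b = c")
      case True
      then show ?thesis using that meet by simp
    next
      case False
      \<comment> \<open>Inserting the swap of b and c twice splits the pair into two pairs of swaps
        that share a point.\<close>
      then have "(\<langle>a \<leftrightarrow> b\<rangle> * \<langle>b \<leftrightarrow> c\<rangle>) * (\<langle>b \<leftrightarrow> c\<rangle> * \<langle>c \<leftrightarrow> d\<rangle>) \<in> H"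
        using that by (intro mult meet)
      then show ?thesis
        by (simp add: mult.assoc swap_mult_cancel)
    qed
  qed
  \<comment> \<open>The induction on the number of swaps must also cover odd lengths: there the
    claim is that one further swap, whichever it is, leads into \<open>H\<close>.\<close>
  have gen: "(even n \<longrightarrow> (\<forall>s. apply s = p \<longrightarrow> s \<in> H)) \<and>
      (odd n \<longrightarrow> (\<forall>s. apply s = p \<longrightarrow> (\<forall>a b. a \<noteq> b \<longrightarrow> \<langle>a \<leftrightarrow> b\<rangle> * s \<in> H)))"
    if "swapidseq n p" for n p
    using that
  proof induction
    case id
    then show ?case
      using one by (metis apply_one even_zero perm_eqI)
  next
    case (comp_Suc n p a b)
    have dec: "apply (\<langle>a \<leftrightarrow> b\<rangle> * s) = p" if "apply s = Transposition.transpose a b \<circ> p" for s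
      using that by (simp add: apply_times swap.rep_eq fun_eq_iff)
    show ?case
    proof (cases "even n")
      case True
      have "\<langle>c \<leftrightarrow> d\<rangle> * s \<in> H" if "apply s = Transposition.transpose a b \<circ> p" "c \<noteq> d" for s c d
      proof -
        have "\<langle>a \<leftrightarrow> b\<rangle> * s \<in> H"
          using comp_Suc.IH True dec[OF that(1)] by blast
        then have "(\<langle>c \<leftrightarrow> d\<rangle> * \<langle>a \<leftrightarrow> b\<rangle>) * (\<langle>a \<leftrightarrow> b\<rangle> * s) \<in> H"
          by (rule mult[OF swaps[OF that(2) comp_Suc.hyps(2)]])
        then show ?thesis
          by (simp add: mult.assoc swap_mult_cancel)
      qed
      then show ?thesis
        using True by (simp add: o_def)
    next
      case False
      have "s \<in> H" if "apply s = Transposition.transpose a b \<circ> p" for s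
      proof -
        have "\<langle>a \<leftrightarrow> b\<rangle> * (\<langle>a \<leftrightarrow> b\<rangle> * s) \<in> H"
          using comp_Suc.IH comp_Suc.hyps False dec[OF that] by blast
        then show ?thesis
          by (simp add: swap_mult_cancel)
      qed
      then show ?thesis
        using False by (simp add: o_def)
    qed
  qed
  obtain n where n: "swapidseq n (apply s)"
    using permutation_apply[of s] unfolding permutation_def by blast
  then have "even n"
    using evenperm_unique[OF n] even by blast
  with gen[OF n] show ?thesis
    by blast
qed

text \<open>Write g_k and g_l for the conjugates of \<open>g\<close> by the swaps of i with k and of
  i with l. They differ only in how they treat j, k and l, and the three-cycle c sending j to l, l
  to k and k to j accounts for this. So the inverse of g_k times g_l is c for every \<open>g\<close>
  sending j to i.\<close>

lemma conjugate_swaps_mult: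
  assumes g: "g \<langle>$\<rangle> j = i" and "i \<noteq> j" and kl: "k \<notin> affected g" "l \<notin> affected g" "k \<noteq> l"
  shows "\<langle>i \<leftrightarrow> l\<rangle> * g * \<langle>i \<leftrightarrow> l\<rangle> = \<langle>i \<leftrightarrow> k\<rangle> * g * \<langle>i \<leftrightarrow> k\<rangle> * (\<langle>j \<leftrightarrow> l\<rangle> * \<langle>l \<leftrightarrow> k\<rangle>)"
proof (rule perm_eqI)
  fix z
  have gkl: "g \<langle>$\<rangle> k = k" "g \<langle>$\<rangle> l = l"
    using kl by (auto simp: in_affected)
  have ne: "i \<noteq> k" "i \<noteq> l" "j \<noteq> k" "j \<noteq> l" "g \<langle>$\<rangle> i \<noteq> i"
    using gkl g \<open>i \<noteq> j\<close> by (auto dest: apply_inj[THEN iffD1, of g])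
  have val: "g \<langle>$\<rangle> y = i \<longleftrightarrow> y = j" "g \<langle>$\<rangle> y = k \<longleftrightarrow> y = k" "g \<langle>$\<rangle> y = l \<longleftrightarrow> y = l" for y
    using apply_inj[of g y] g gkl by metis+
  consider "z = i" | "z = j" | "z = k" | "z = l" | "z \<notin> {i, j, k, l}"
    by blast
  then show "(\<langle>i \<leftrightarrow> l\<rangle> * g * \<langle>i \<leftrightarrow> l\<rangle>) \<langle>$\<rangle> z
      = (\<langle>i \<leftrightarrow> k\<rangle> * g * \<langle>i \<leftrightarrow> k\<rangle> * (\<langle>j \<leftrightarrow> l\<rangle> * \<langle>l \<leftrightarrow> k\<rangle>)) \<langle>$\<rangle> z"
    by cases (simp_all add: apply_times g gkl ne val kl(3) \<open>i \<noteq> j\<close>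
        ne[symmetric] kl(3)[symmetric] \<open>i \<noteq> j\<close>[symmetric])
qed

text \<open>Comparing values point by point recovers \<open>x\<close> and \<open>y\<close> from the
  equation. It excludes cross terms between different permutations, so the coefficient at c becomes
  a sum of squared moduli.\<close>

lemma conjugate_swaps_mult_unique:
  assumes x: "x \<in> supported_perms F" and y: "y \<in> supported_perms F"
    and "i \<in> F" "j \<in> F" "i \<noteq> j" "k \<notin> F" "l \<notin> F" "k \<noteq> l"
    and eq: "\<langle>i \<leftrightarrow> l\<rangle> * x * \<langle>i \<leftrightarrow> l\<rangle> = \<langle>i \<leftrightarrow> k\<rangle> * y * \<langle>i \<leftrightarrow> k\<rangle> * (\<langle>j \<leftrightarrow> l\<rangle> * \<langle>l \<leftrightarrow> k\<rangle>)"
  shows "x = y"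
proof (rule perm_eq_onI[OF x y])
  have ne: "i \<noteq> k" "i \<noteq> l" "j \<noteq> k" "j \<noteq> l"
    using assms by auto
  have fixed: "x \<langle>$\<rangle> k = k" "x \<langle>$\<rangle> l = l" "y \<langle>$\<rangle> k = k" "y \<langle>$\<rangle> l = l"
    using assms by (simp_all add: supported_perms_fixed)
  have E: "\<langle>i \<leftrightarrow> l\<rangle> \<langle>$\<rangle> (x \<langle>$\<rangle> (\<langle>i \<leftrightarrow> l\<rangle> \<langle>$\<rangle> z))
      = \<langle>i \<leftrightarrow> k\<rangle> \<langle>$\<rangle> (y \<langle>$\<rangle> (\<langle>i \<leftrightarrow> k\<rangle> \<langle>$\<rangle> (\<langle>j \<leftrightarrow> l\<rangle> \<langle>$\<rangle> (\<langle>l \<leftrightarrow> k\<rangle> \<langle>$\<rangle> z))))" for z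
    using arg_cong[OF eq, of "\<lambda>s. s \<langle>$\<rangle> z"] by (simp add: apply_times)
  \<comment> \<open>Evaluating the equation at j forces x to send j to i; evaluating it at k does
    the same for y.\<close>
  have xj: "x \<langle>$\<rangle> j = i"
    using E[of j] fixed ne assms(5,8) by simp
  have "k = \<langle>i \<leftrightarrow> k\<rangle> \<langle>$\<rangle> (y \<langle>$\<rangle> j)"
    using E[of k] fixed ne assms(5,8) by simp
  then have yj: "y \<langle>$\<rangle> j = i"
    by (metis apply_swap_eq_iff(2))
  fix z assume "z \<in> F"
  have val: "x \<langle>$\<rangle> w \<noteq> i" "x \<langle>$\<rangle> w \<noteq> l" "y \<langle>$\<rangle> w \<noteq> i" "y \<langle>$\<rangle> w \<noteq> k" if "w \<in> F" "w \<noteq> j" for w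
    using that assms supported_perms_apply_in[OF x that(1)] supported_perms_apply_in[OF y that(1)]
      xj yj apply_inj[of x w j] apply_inj[of y w j] by auto
  consider "z = i" | "z = j" | "z \<notin> {i, j, k, l}"
    using \<open>z \<in> F\<close> assms by blast
  then show "x \<langle>$\<rangle> z = y \<langle>$\<rangle> z"
  proof cases
    case 1
    then show ?thesis
      using E[of l] val[of i] ne assms by simp
  next
    case 2
    then show ?thesis
      using xj yj by simp
  next
    case 3
    then show ?thesis
      using E[of z] val[of z] ne \<open>z \<in> F\<close> by simp
  qed
qed

text \<open>The left side fixes k while the right side sends k to l. Hence no pair of terms
  contributes to the coefficient at the inverse of c.\<close>

lemma conjugate_swaps_mult_inverse_neq:
  assumes x: "x \<in> supported_perms F" and y: "y \<in> supported_perms F"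
    and "i \<in> F" "j \<in> F" "k \<notin> F" "l \<notin> F" "k \<noteq> l"
  shows "\<langle>i \<leftrightarrow> l\<rangle> * x * \<langle>i \<leftrightarrow> l\<rangle> \<noteq> \<langle>i \<leftrightarrow> k\<rangle> * y * \<langle>i \<leftrightarrow> k\<rangle> * (\<langle>l \<leftrightarrow> k\<rangle> * \<langle>j \<leftrightarrow> l\<rangle>)"
    (is "?A \<noteq> ?B")
proof -
  have fixed: "x \<langle>$\<rangle> k = k" "y \<langle>$\<rangle> l = l" "i \<noteq> k" "i \<noteq> l" "j \<noteq> k"
    using assms by (auto simp: supported_perms_fixed)
  then have "?A \<langle>$\<rangle> k = k" "?B \<langle>$\<rangle> k = l"
    using \<open>k \<noteq> l\<close> by (simp_all add: apply_times)
  then show ?thesis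
    using \<open>k \<noteq> l\<close> by metis
qed

subsection \<open>Averaging over conjugates\<close>

lemma ell2_orthogonal:
  assumes "\<And>h. ell2_apply f h = 0 \<or> ell2_apply g h = 0"
  shows "orthogonal f g"
proof -
  have "(\<lambda>h. cnj (ell2_apply f h) * ell2_apply g h) = (\<lambda>_. 0)"
    using assms by auto
  then show ?thesis
    by (simp add: orthogonal_def inner_ell2_def cinner_ell2_def)
qed

section \<open>Conjugates of an operator and their means\<close>

definition conj_op :: "'g::group_mult \<Rightarrow> ('g ell2 \<Rightarrow>\<^sub>L 'g ell2) \<Rightarrow> ('g ell2 \<Rightarrow>\<^sub>L 'g ell2)" where
  "conj_op g T = left_reg g o\<^sub>L T o\<^sub>L adjoint_op (left_reg g)"

lemma op_coeff_conj_op: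
  "T \<in> right_invariant \<Longrightarrow> op_coeff (conj_op g T) h = op_coeff T (inverse g * h * g)"
  by (simp add: conj_op_def op_coeff_conj)

lemma conj_op_right_invariant: "T \<in> right_invariant \<Longrightarrow> conj_op g T \<in> right_invariant"
  using von_neumann_algebra_right_invariant left_reg_right_invariant
  unfolding conj_op_def by (intro vN_comp vN_adjoint) auto

lemma conj_op_add: "conj_op g (S + T) = conj_op g S + conj_op g T"
  by (rule blinfun_eqI) (simp add: conj_op_def blinfun.add_left blinfun.add_right)

text \<open>On delta_1 the conjugate yields a left translate of a right translate of T delta_1, and
  both translations are isometric.\<close>

lemma norm_conj_op_delta:
  assumes "T \<in> right_invariant"
  shows "norm (conj_op g T (delta 1)) = norm (T (delta 1))"
  using right_invariant_delta[OF assms, of "inverse g"]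
  by (simp add: conj_op_def adjoint_left_reg left_reg_delta norm_left_reg_apply norm_right_translate)

lemma norm_conj_op: "norm (conj_op g T) \<le> norm T"
proof (rule norm_blinfun_bound)
  fix f
  have "norm (conj_op g T f) = norm (T (left_reg (inverse g) f))"
    by (simp add: conj_op_def adjoint_left_reg norm_left_reg_apply)
  also have "\<dots> \<le> norm T * norm f"
    using norm_blinfun[of T "left_reg (inverse g) f"] by (simp add: norm_left_reg_apply)
  finally show "norm (conj_op g T f) \<le> norm T * norm f" .
qed simp

definition mean_op :: "nat \<Rightarrow> (nat \<Rightarrow> 'g::group_mult) \<Rightarrow> ('g ell2 \<Rightarrow>\<^sub>L 'g ell2) \<Rightarrow> ('g ell2 \<Rightarrow>\<^sub>L 'g ell2)"
  where "mean_op n s T = scaleR (1 / real n) (\<Sum>j<n. conj_op (s j) T)"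

lemma mean_op_add: "mean_op n s (S + T) = mean_op n s S + mean_op n s T"
  by (simp add: mean_op_def conj_op_add sum.distrib scaleR_right_distrib)

lemma norm_mean_op: "norm (mean_op n s T) \<le> norm T"
proof (cases "n = 0")
  case False
  have "norm (\<Sum>j<n. conj_op (s j) T) \<le> (\<Sum>j<n. norm T)"
    by (rule sum_norm_le) (rule norm_conj_op)
  then show ?thesis
    using False by (simp add: mean_op_def field_simps)
qed (simp add: mean_op_def)

lemma norm_mean_op_delta:
  assumes "T \<in> right_invariant"
  shows "norm (mean_op n s T (delta 1)) \<le> norm (T (delta 1))"
proof (cases "n = 0")
  case False
  have "norm (\<Sum>j<n. conj_op (s j) T (delta 1)) \<le> (\<Sum>j<n. norm (T (delta 1)))"
    by (rule sum_norm_le) (simp add: norm_conj_op_delta[OF assms])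
  then show ?thesis
    using False by (simp add: mean_op_def blinfun.scaleR_left blinfun.sum_left field_simps)
qed (simp add: mean_op_def)

lemma mean_op_fixed:
  assumes "n > 0" "\<And>j. conj_op (s j) T = T"
  shows "mean_op n s T = T"
  using assms by (simp add: mean_op_def sum_constant_scaleR)

text \<open>Disjoint supports make the conjugates orthogonal on delta_1, so the mean of n vectors of
  equal norm shrinks by the square root of n.\<close>

lemma norm_mean_op_disjoint:
  assumes T: "T \<in> right_invariant" and "n > 0"
    and disj: "\<And>i j h. i \<noteq> j \<Longrightarrow> op_coeff (conj_op (s i) T) h = 0 \<or> op_coeff (conj_op (s j) T) h = 0"
  shows "(norm (mean_op n s T (delta 1)))\<^sup>2 = (norm (T (delta 1)))\<^sup>2 / n"
proof -
  have "(norm (\<Sum>j<n. conj_op (s j) T (delta 1)))\<^sup>2 = (\<Sum>j<n. (norm (conj_op (s j) T (delta 1)))\<^sup>2)"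
    using disj
    by (intro norm_sum_Pythagorean) (auto simp: pairwise_def op_coeff_def intro!: ell2_orthogonal)
  also have "\<dots> = real n * (norm (T (delta 1)))\<^sup>2"
    by (simp add: norm_conj_op_delta[OF T])
  finally show ?thesis
    using \<open>n > 0\<close>
    by (simp add: mean_op_def blinfun.scaleR_left blinfun.sum_left power_divide power2_eq_square)
qed

text \<open>Permutations with disjoint supports commute, so conjugation by \<open>s\<close> moves
  none of the coefficients of the truncation.\<close>

lemma conj_op_finite_part:
  assumes "\<And>x. x \<in> F \<Longrightarrow> s \<langle>$\<rangle> x = x" "finite F"
  shows "conj_op s (finite_part (supported_perms F) T) = finite_part (supported_perms F) T"
    (is "_ = ?X")
proof (rule right_invariant_eqI)
  have s': "inverse s \<langle>$\<rangle> x = x" if "x \<in> F" for x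
    using assms(1)[OF that] perm_inverse_apply(1) by metis
  show "op_coeff (conj_op s ?X) = op_coeff ?X"
  proof
    fix h
    have eq: "inverse s * h * s = h" if "h \<in> supported_perms F"
      using supported_perms_conj[of F "inverse s" h] s' that by simp
    have eq': "inverse s * h * s = h" if "inverse s * h * s \<in> supported_perms F"
      using supported_perms_conj[of F s "inverse s * h * s"] assms that
      by (simp add: mult.assoc group_inverse_mult_cancel group_right_inverse)
    show "op_coeff (conj_op s ?X) h = op_coeff ?X h"
      using eq eq'
      by (auto simp: op_coeff_conj_op finite_part_right_invariant op_coeff_finite_part
          finite_supported_perms assms(2))
  qed
qed (simp_all add: conj_op_right_invariant finite_part_right_invariant)

text \<open>Split T = X + Y + R, where X is the truncation to \<open>supported_perms F\<close>, Y a
  finite remainder and R small on delta_1. Averaging over spreading permutations keeps X, shrinks Y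
  and does not enlarge R delta_1.\<close>

lemma mean_op_approx_finite_part:
  fixes T :: "'a perm ell2 \<Rightarrow>\<^sub>L 'a perm ell2"
  assumes inf: "infinite (UNIV :: 'a set)" and T: "T \<in> right_invariant" and F: "finite F"
    and e: "e > 0"
  shows "\<exists>n s. norm ((mean_op n s T - finite_part (supported_perms F) T) (delta 1)) < e"
proof -
  let ?f = "T (delta 1)" and ?S = "supported_perms F"
  have "\<forall>\<^sub>F B in finite_subsets_at_top UNIV. dist (truncate B ?f) ?f < e / 2 \<and> finite B \<and> ?S \<subseteq> B"
    using e finite_supported_perms[OF F]
    by (intro eventually_conj tendstoD[OF truncate_tendsto]) (auto simp: eventually_finite_subsets_at_top)
  then obtain B where B: "norm (?f - truncate B ?f) < e / 2" "finite B" "?S \<subseteq> B"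
    by (auto simp: dist_norm norm_minus_commute
        dest: eventually_happens'[OF finite_subsets_at_top_neq_bot])
  \<comment> \<open>All coefficients kept in \<open>B\<close> belong to permutations supported in
    this finite set, so one family of spreading permutations serves them all.\<close>
  define G where "G = (\<Union>h\<in>B. affected h)"
  have G: "finite G" "B \<subseteq> supported_perms G"
    using B by (auto simp: G_def supported_perms_def)
  obtain s :: "nat \<Rightarrow> 'a perm" where s: "\<And>j x. x \<in> F \<Longrightarrow> s j \<langle>$\<rangle> x = x"
    "\<And>i j g h. i \<noteq> j \<Longrightarrow> g \<in> supported_perms G - ?S \<Longrightarrow> h \<in> supported_perms G - ?S \<Longrightarrow>
      s i * g * inverse (s i) \<noteq> s j * h * inverse (s j)"
    using perms_spreading[OF inf F G(1)] by blast
  define X where "X = finite_part ?S T"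
  define Y where "Y = finite_part (B - ?S) T"
  define R where "R = T - X - Y"
  have ri: "X \<in> right_invariant" "Y \<in> right_invariant"
    by (simp_all add: X_def Y_def finite_part_right_invariant)
  then have "R \<in> right_invariant"
    using T unfolding R_def by (intro vN_diff von_neumann_algebra_right_invariant)
  \<comment> \<open>With this many terms, the factor 1 / sqrt n brings the mean of Y below e / 2 on
    delta_1.\<close>
  obtain n :: nat where n: "(norm (Y (delta 1)) / (e / 2))\<^sup>2 < n"
    using reals_Archimedean2 by blast
  then have n0: "n > 0"
    by (metis gr0I not_less of_nat_0 zero_le_power2)
  have "truncate B ?f = X (delta 1) + Y (delta 1)"
    unfolding X_def Y_def finite_part_delta truncate_def
    using sum.subset_diff[OF B(3,2), of "\<lambda>h. scaleC_ell2 (ell2_apply ?f h) (delta h)"]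
    by (simp add: add.commute)
  then have R1: "norm (R (delta 1)) < e / 2"
    using B(1) by (simp add: R_def blinfun.diff_left blinfun.add_left diff_diff_eq)
  have "op_coeff (conj_op (s i) Y) h = 0 \<or> op_coeff (conj_op (s j) Y) h = 0" if "i \<noteq> j" for i j h
  proof (rule ccontr)
    assume "\<not> ?thesis"
    then have "inverse (s i) * h * s i \<in> B - ?S" "inverse (s j) * h * s j \<in> B - ?S"
      unfolding op_coeff_conj_op[OF ri(2)]
      by (auto simp: Y_def op_coeff_finite_part B split: if_splits)
    then show False
      using s(2)[OF that, of "inverse (s i) * h * s i" "inverse (s j) * h * s j"] G(2)
      by (auto simp: mult.assoc group_inverse_mult_cancel group_right_inverse)
  qed
  then have "(norm (mean_op n s Y (delta 1)))\<^sup>2 = (norm (Y (delta 1)))\<^sup>2 / n"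
    using ri n0 by (intro norm_mean_op_disjoint)
  also have "\<dots> < (e / 2)\<^sup>2"
    using n n0 e by (simp add: power_divide field_simps)
  finally have Y1: "norm (mean_op n s Y (delta 1)) < e / 2"
    using e by (intro power_less_imp_less_base[of _ 2 "e / 2"]) auto
  have "T = X + (Y + R)"
    by (simp add: R_def)
  then have "mean_op n s T = mean_op n s X + (mean_op n s Y + mean_op n s R)"
    by (metis mean_op_add)
  also have "mean_op n s X = X"
    unfolding X_def using n0 s(1) F by (intro mean_op_fixed conj_op_finite_part)
  finally have "(mean_op n s T - X) (delta 1) = mean_op n s Y (delta 1) + mean_op n s R (delta 1)"
    by (simp add: blinfun.add_left)
  also have "norm \<dots> \<le> norm (mean_op n s Y (delta 1)) + norm (R (delta 1))"
    using norm_mean_op_delta[OF \<open>R \<in> right_invariant\<close>, of n s]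
    by (intro order_trans[OF norm_triangle_ineq] add_left_mono)
  also have "\<dots> < e"
    using Y1 R1 by simp
  finally show ?thesis
    unfolding X_def by blast
qed

section \<open>Invariant algebras over an infinite set of points, and truncation inside them\<close>

locale invariant_vN =
  fixes P :: "('a perm ell2 \<Rightarrow>\<^sub>L 'a perm ell2) set"
  assumes infinite_points: "infinite (UNIV :: 'a set)"
    and vN: "von_neumann_algebra P"
    and right_inv: "P \<subseteq> right_invariant"
    and conj_closed: "T \<in> P \<Longrightarrow> conj_op g T \<in> P"
begin

lemma mean_op_in: "T \<in> P \<Longrightarrow> mean_op n s T \<in> P"
proof -
  assume "T \<in> P"
  then have "scalar_op (complex_of_real (1 / real n)) o\<^sub>L (\<Sum>j<n. conj_op (s j) T) \<in> P"
    by (intro vN_scale[OF vN] vN_sum[OF vN] conj_closed)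
  also have "scalar_op (complex_of_real (1 / real n)) o\<^sub>L (\<Sum>j<n. conj_op (s j) T) = mean_op n s T"
    by (rule blinfun_eqI) (simp add: mean_op_def scalar_op.rep_eq blinfun.scaleR_left scaleR_ell2_def)
  finally show ?thesis .
qed

text \<open>The means lie in P, have norm at most that of \<open>T\<close> and converge to the
  truncation on delta_1, hence strongly. Their norm bound passes to the limit and keeps the
  truncations over all finite \<open>F\<close> uniformly bounded.\<close>

lemma
  assumes T: "T \<in> P" and F: "finite F"
  shows finite_part_mem: "finite_part (supported_perms F) T \<in> P" (is "?X \<in> P")
    and norm_finite_part: "norm (finite_part (supported_perms F) T) \<le> norm T"
proof -
  have "\<exists>A. A \<in> P \<and> norm A \<le> norm T \<and> norm ((A - ?X) (delta 1)) < inverse (real (Suc n))" for n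
    using mean_op_approx_finite_part[OF infinite_points _ F, of T "inverse (real (Suc n))"] T right_inv
      mean_op_in[OF T] norm_mean_op[of _ _ T] by (metis inverse_positive_iff_positive of_nat_0_less_iff
        subsetD zero_less_Suc)
  then obtain A where A: "\<And>n. A n \<in> P" "\<And>n. norm (A n) \<le> norm T"
    "\<And>n. norm ((A n - ?X) (delta 1)) < inverse (real (Suc n))"
    by metis
  have "(\<lambda>n. (A n - ?X) (delta 1)) \<longlonglongrightarrow> 0"
    by (rule Lim_null_comparison[OF _ LIMSEQ_inverse_real_of_nat])
      (use A(3) in \<open>auto intro!: always_eventually less_imp_le\<close>)
  then have lim1: "(\<lambda>n. A n (delta 1)) \<longlonglongrightarrow> ?X (delta 1)"
    by (simp add: blinfun.diff_left LIM_zero_iff)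
  have lim: "(\<lambda>n. A n f) \<longlonglongrightarrow> ?X f" for f
    by (rule right_invariant_tendsto[OF _ finite_part_right_invariant always_eventually lim1])
      (use A(1,2) right_inv in auto)
  show "?X \<in> P"
    using vN lim by (rule von_neumann_algebra_limit) (simp_all add: A)
  show "norm ?X \<le> norm T"
  proof (rule norm_blinfun_bound)
    fix f
    have "norm (A n f) \<le> norm T * norm f" for n
      using A(2)[of n] by (intro order_trans[OF norm_blinfun] mult_right_mono) auto
    then show "norm (?X f) \<le> norm T * norm f"
      by (intro Lim_norm_ubound[OF _ lim]) auto
  qed simp
qed

end

subsection \<open>Invariant subalgebras\<close>

text \<open>Here \<open>S\<close> is a combination of 1 and u_g, and one solves for u_g.\<close>

lemma left_reg_in_if_coeff_nonzero:
  assumes M: "von_neumann_algebra M" "M \<subseteq> right_invariant" and S: "S \<in> M"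
    and g: "g \<noteq> 1" "op_coeff S g \<noteq> 0" and zero: "\<And>h. h \<noteq> 1 \<Longrightarrow> h \<noteq> g \<Longrightarrow> op_coeff S h = 0"
  shows "left_reg g \<in> M"
proof -
  let ?R = "scalar_op (inverse (op_coeff S g)) o\<^sub>L (S - scalar_op (op_coeff S 1))"
  have R: "?R \<in> M"
    using M(1) S by (intro vN_scale vN_diff vN_scalar)
  have "?R = left_reg g"
  proof (rule right_invariant_eqI)
    show "op_coeff ?R = op_coeff (left_reg g)"
    proof
      fix h
      have "op_coeff ?R h = inverse (op_coeff S g) * (op_coeff S h - (if h = 1 then op_coeff S 1 else 0))"
        by (simp add: op_coeff_def scalar_op.rep_eq scaleC_ell2.rep_eq blinfun.diff_left
            minus_ell2_apply delta.rep_eq)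
      also have "\<dots> = op_coeff (left_reg g) h"
        using g zero by (auto simp: op_coeff_left_reg)
      finally show "op_coeff ?R h = op_coeff (left_reg g) h" .
    qed
  qed (use R M left_reg_right_invariant in auto)
  with R show ?thesis by simp
qed

text \<open>The coefficient is the inner product of S delta_z with T delta_1. The finite support of
  T delta_1 turns this convolution into a finite sum.\<close>

lemma op_coeff_adjoint_comp:
  assumes S: "S \<in> right_invariant" and "finite X" "\<And>h. h \<notin> X \<Longrightarrow> op_coeff T h = 0"
  shows "op_coeff (adjoint_op S o\<^sub>L T) z = (\<Sum>h\<in>X. cnj (op_coeff S (h * inverse z)) * op_coeff T h)"
proof -
  have "op_coeff (adjoint_op S o\<^sub>L T) z = cinner_ell2 (delta z) (adjoint_op S (T (delta 1)))"
    by (simp add: op_coeff_def cinner_delta)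
  also have "\<dots> = cinner_ell2 (S (delta z)) (T (delta 1))"
    using S by (simp add: right_invariant_def cinner_adjoint_op_right)
  also have "\<dots> = (\<Sum>\<^sub>\<infinity>h. cnj (op_coeff S (h * inverse z)) * op_coeff T h)"
    by (simp add: cinner_ell2_def right_invariant_delta[OF S, of z] right_translate.rep_eq op_coeff_def)
  also have "\<dots> = (\<Sum>\<^sub>\<infinity>h\<in>X. cnj (op_coeff S (h * inverse z)) * op_coeff T h)"
    using assms(3) by (intro infsum_cong_neutral) auto
  finally show ?thesis
    using assms(2) by simp
qed

lemma conj_left_reg: "conj_op g (left_reg h) = left_reg (g * h * inverse g)"
  by (simp add: conj_op_def adjoint_left_reg left_reg_mult)

section \<open>Generating the algebra from one swap or one three-cycle\<close>

context invariant_vN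
begin

lemma left_reg_mult_mem: "left_reg g \<in> P \<Longrightarrow> left_reg h \<in> P \<Longrightarrow> left_reg (g * h) \<in> P"
  by (simp add: left_reg_mult vN_comp[OF vN])

lemma left_reg_one_mem: "left_reg 1 \<in> P"
  by (simp add: left_reg_one vN_id[OF vN])

lemma left_reg_swap_mem:
  assumes "T \<in> P" "a \<noteq> b" "op_coeff T \<langle>a \<leftrightarrow> b\<rangle> \<noteq> 0"
  shows "left_reg \<langle>a \<leftrightarrow> b\<rangle> \<in> P"
proof (rule left_reg_in_if_coeff_nonzero[OF vN right_inv])
  have "affected \<langle>a \<leftrightarrow> b\<rangle> \<noteq> {}"
    using assms(2) by (simp add: affected_swap)
  then show "\<langle>a \<leftrightarrow> b\<rangle> \<noteq> 1"
    by auto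
  show "finite_part (supported_perms {a, b}) T \<in> P"
    using assms by (intro finite_part_mem) auto
qed (use assms in \<open>auto simp: op_coeff_finite_part supported_perms_pair\<close>)

lemma left_reg_all_swaps_mem:
  assumes "left_reg \<langle>a \<leftrightarrow> b\<rangle> \<in> P" "a \<noteq> b" "c \<noteq> d"
  shows "left_reg \<langle>c \<leftrightarrow> d\<rangle> \<in> P"
proof -
  have "inj_on (\<lambda>x. if x = a then c else d) {a, b}"
    using assms by (auto simp: inj_on_def)
  then obtain s :: "'a perm" where "\<And>x. x \<in> {a, b} \<Longrightarrow> s \<langle>$\<rangle> x = (if x = a then c else d)"
    using perm_extends_inj[of "{a, b}"] by blast
  then have "s \<langle>$\<rangle> a = c" "s \<langle>$\<rangle> b = d"
    using assms by auto
  then show ?thesis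
    using conj_closed[OF assms(1), of s] by (simp add: conj_left_reg swap_conj)
qed

lemma left_reg_all_three_cycles_mem:
  assumes "left_reg (\<langle>a \<leftrightarrow> b\<rangle> * \<langle>b \<leftrightarrow> c\<rangle>) \<in> P" "distinct [a, b, c]" "distinct [a', b', c']"
  shows "left_reg (\<langle>a' \<leftrightarrow> b'\<rangle> * \<langle>b' \<leftrightarrow> c'\<rangle>) \<in> P"
proof -
  have "inj_on (\<lambda>x. if x = a then a' else if x = b then b' else c') {a, b, c}"
    using assms by (auto simp: inj_on_def)
  then obtain s :: "'a perm" where
    "\<And>x. x \<in> {a, b, c} \<Longrightarrow> s \<langle>$\<rangle> x = (if x = a then a' else if x = b then b' else c')"
    using perm_extends_inj[of "{a, b, c}"] by blast
  then have s: "s \<langle>$\<rangle> a = a'" "s \<langle>$\<rangle> b = b'" "s \<langle>$\<rangle> c = c'"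
    using assms by auto
  have "s * (\<langle>a \<leftrightarrow> b\<rangle> * \<langle>b \<leftrightarrow> c\<rangle>) * inverse s
      = (s * \<langle>a \<leftrightarrow> b\<rangle> * inverse s) * (s * \<langle>b \<leftrightarrow> c\<rangle> * inverse s)"
    by (simp add: mult.assoc perm_mult_inverse_cancel)
  then show ?thesis
    using conj_closed[OF assms(1), of s] by (simp only: conj_left_reg swap_conj s)
qed

lemma even_left_reg_mem:
  assumes "left_reg (\<langle>a \<leftrightarrow> b\<rangle> * \<langle>b \<leftrightarrow> c\<rangle>) \<in> P" "distinct [a, b, c]" "evenperm (apply s)"
  shows "left_reg s \<in> P"
  using even_perm_generated[of "{g. left_reg g \<in> P}" s] assms left_reg_one_mem left_reg_mult_mem
    left_reg_all_three_cycles_mem by blast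

text \<open>Two swaps in P compose to a three-cycle, which yields all even permutations; an odd one
  becomes even after multiplication by the given swap.\<close>

lemma all_left_reg_mem:
  assumes "left_reg \<langle>a \<leftrightarrow> b\<rangle> \<in> P" "a \<noteq> b"
  shows "left_reg s \<in> P"
proof -
  obtain c where "c \<notin> {a, b}"
    using ex_new_if_finite[OF infinite_points, of "{a, b}"] by auto
  then have c: "distinct [a, b, c]" "left_reg (\<langle>a \<leftrightarrow> b\<rangle> * \<langle>b \<leftrightarrow> c\<rangle>) \<in> P"
    using assms left_reg_all_swaps_mem[OF assms, of b c] by (auto intro: left_reg_mult_mem)
  show ?thesis
  proof (cases "evenperm (apply s)")
    case True
    then show ?thesis by (rule even_left_reg_mem[OF c(2,1)])
  next
    case False
    then have "left_reg (\<langle>a \<leftrightarrow> b\<rangle> * s) \<in> P"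
      using assms(2) by (intro even_left_reg_mem[OF c(2,1)]) (simp add: evenperm_swap_mult)
    then have "left_reg (\<langle>a \<leftrightarrow> b\<rangle> * (\<langle>a \<leftrightarrow> b\<rangle> * s)) \<in> P"
      by (rule left_reg_mult_mem[OF assms(1)])
    then show ?thesis
      by (simp add: swap_mult_cancel)
  qed
qed

lemma swap_or_three_cycle_mem:
  assumes T: "T \<in> P" and g: "g \<noteq> 1" "op_coeff T g \<noteq> 0"
  obtains a b where "a \<noteq> b" "left_reg \<langle>a \<leftrightarrow> b\<rangle> \<in> P"
  | a b c where "distinct [a, b, c]" "left_reg (\<langle>a \<leftrightarrow> b\<rangle> * \<langle>b \<leftrightarrow> c\<rangle>) \<in> P"
proof -
  define F where "F = affected g"
  let ?S = "supported_perms F"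
  have "F \<noteq> {}" and F: "finite F" "finite ?S" and gF: "g \<in> ?S"
    using g finite_supported_perms[of "affected g"] by (auto simp: F_def supported_perms_def)
  then obtain i where i: "i \<in> F" by blast
  define j where "j = inverse g \<langle>$\<rangle> i"
  have gj: "g \<langle>$\<rangle> j = i"
    by (simp add: j_def)
  have j: "j \<in> F" "i \<noteq> j"
    using gj i apply_affected[of g j] by (auto simp: F_def in_affected)
  obtain k where k: "k \<notin> F"
    using ex_new_if_finite[OF infinite_points F(1)] by blast
  obtain l where "l \<notin> insert k F"
    using ex_new_if_finite[OF infinite_points, of "insert k F"] F by auto
  then have l: "l \<notin> F" "k \<noteq> l" by auto
  let ?tk = "\<langle>i \<leftrightarrow> k\<rangle>" and ?tl = "\<langle>i \<leftrightarrow> l\<rangle>" and ?c = "\<langle>j \<leftrightarrow> l\<rangle> * \<langle>l \<leftrightarrow> k\<rangle>"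
  define p where "p = finite_part ?S T"
  have p: "p \<in> P" "p \<in> right_invariant"
    using finite_part_mem[OF T F(1)] by (auto simp: p_def finite_part_right_invariant)
  have p_coeff: "op_coeff p x = (if x \<in> ?S then op_coeff T x else 0)" for x
    using F by (simp add: p_def op_coeff_finite_part)
  define Q where "Q = adjoint_op (conj_op ?tk p) o\<^sub>L conj_op ?tl p"
  have Q: "Q \<in> P"
    unfolding Q_def by (intro vN_comp vN_adjoint vN conj_closed p)
  \<comment> \<open>For given z and x this is the only index y whose conjugate y_k satisfies x_l =
    y_k z, so it is the term of p_k paired with x in the coefficient at z.\<close>
  define y where "y z x = ?tk * (?tl * x * ?tl * inverse z) * ?tk" for z x
  have y_eq: "?tl * x * ?tl = ?tk * y z x * ?tk * z" for z x
    by (simp add: y_def mult.assoc swap_mult_cancel)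
  have Q_coeff: "op_coeff Q z = (\<Sum>x\<in>?S. cnj (op_coeff p (y z x)) * op_coeff p x)" for z
  proof -
    \<comment> \<open>Conjugation by the swap is an involution; reindexing along it turns the sum
      over the support of p_l into one over the support of p.\<close>
    let ?f = "\<lambda>x. ?tl * x * ?tl"
    have inv: "?f (?f x) = x" for x
      by (simp add: mult.assoc swap_mult_cancel)
    have "op_coeff Q z
        = (\<Sum>h\<in>?f ` ?S. cnj (op_coeff (conj_op ?tk p) (h * inverse z)) * op_coeff (conj_op ?tl p) h)"
      unfolding Q_def
    proof (rule op_coeff_adjoint_comp)
      fix h assume "h \<notin> ?f ` ?S"
      then have "?f h \<notin> ?S"
        using inv by (metis image_eqI)
      then show "op_coeff (conj_op ?tl p) h = 0"
        by (simp add: op_coeff_conj_op p p_coeff)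
    qed (use p F in \<open>auto simp: conj_op_right_invariant\<close>)
    also have "\<dots> = (\<Sum>x\<in>?S. cnj (op_coeff p (y z x)) * op_coeff p x)"
      using inv by (subst sum.reindex) (auto intro!: inj_on_inverseI[where g = ?f] simp: op_coeff_conj_op p y_def)
    finally show ?thesis .
  qed
  have inv_c: "inverse ?c = \<langle>l \<leftrightarrow> k\<rangle> * \<langle>j \<leftrightarrow> l\<rangle>"
    by simp
  have c_nonzero: "op_coeff Q ?c \<noteq> 0"
  proof -
    \<comment> \<open>By uniqueness only terms with y = x survive. They are nonnegative, and the one
      at g is positive.\<close>
    let ?w = "\<lambda>x. if y ?c x = x then (cmod (op_coeff p x))\<^sup>2 else 0"
    have "cnj (op_coeff p (y ?c x)) * op_coeff p x = complex_of_real (?w x)" if "x \<in> ?S" for x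
    proof (cases "y ?c x \<in> ?S")
      case True
      then have "y ?c x = x"
        using conjugate_swaps_mult_unique[OF that True i j k l y_eq] by simp
      then show ?thesis
        by (simp add: complex_norm_square mult.commute del: of_real_power)
    next
      case False
      with that show ?thesis by (auto simp: p_coeff)
    qed
    then have "op_coeff Q ?c = complex_of_real (\<Sum>x\<in>?S. ?w x)"
      unfolding Q_coeff of_real_sum by (intro sum.cong refl)
    moreover have "y ?c g = g"
    proof -
      have "?tl * g * ?tl = ?tk * g * ?tk * ?c"
        using k l unfolding F_def by (rule conjugate_swaps_mult[OF gj j(2)])
      then show ?thesis
        unfolding y_def by (simp only:) (simp add: mult.assoc swap_mult_cancel)
    qed
    then have "0 < (\<Sum>x\<in>?S. ?w x)"
      using F gF g by (intro sum_pos2[of _ g]) (auto simp: p_coeff)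
    ultimately show ?thesis
      by (simp only: of_real_eq_0_iff less_imp_neq[symmetric] not_False_eq_True)
  qed
  have inv_c_zero: "op_coeff Q (inverse ?c) = 0"
    unfolding Q_coeff
  proof (rule sum.neutral, rule ballI)
    fix x assume "x \<in> ?S"
    then have "y (inverse ?c) x \<notin> ?S"
      using conjugate_swaps_mult_inverse_neq[OF _ _ i j(1) k l] y_eq inv_c by metis
    then show "cnj (op_coeff p (y (inverse ?c) x)) * op_coeff p x = 0"
      by (simp add: p_coeff)
  qed
  have dist: "distinct [j, l, k]"
    using j k l by auto
  show thesis
  proof (cases "\<exists>a b. a \<noteq> b \<and> op_coeff Q \<langle>a \<leftrightarrow> b\<rangle> \<noteq> 0")
    case True
    then show thesis
      using left_reg_swap_mem[OF Q] that(1) by blast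
  next
    case False
    \<comment> \<open>With no swap coefficients in Q and coefficient 0 at the inverse of c,
      truncating to these three points leaves only multiples of 1 and u_c.\<close>
    let ?X = "supported_perms {j, l, k}"
    have "left_reg ?c \<in> P"
    proof (rule left_reg_in_if_coeff_nonzero[OF vN right_inv])
      show "finite_part ?X Q \<in> P"
        using Q by (intro finite_part_mem) auto
      have "?c \<langle>$\<rangle> j = l"
        using dist by (simp add: apply_times)
      then show "?c \<noteq> 1"
        using dist by auto
      have "?c \<in> ?X"
        by (intro supported_perms_mult supported_perms_swap) auto
      then show "op_coeff (finite_part ?X Q) ?c \<noteq> 0"
        using c_nonzero by (simp add: op_coeff_finite_part finite_supported_perms)
      fix h assume h: "h \<noteq> 1" "h \<noteq> ?c"
      show "op_coeff (finite_part ?X Q) h = 0"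
      proof (cases "h \<in> ?X")
        case True
        then have "h \<in> {\<langle>j \<leftrightarrow> l\<rangle>, \<langle>l \<leftrightarrow> k\<rangle>, \<langle>j \<leftrightarrow> k\<rangle>, inverse ?c}"
          using supported_perms_triple[OF dist True] h unfolding inv_c by blast
        then have "op_coeff Q h = 0"
          using False dist inv_c_zero by auto
        then show ?thesis
          by (simp add: op_coeff_finite_part finite_supported_perms)
      qed (simp add: op_coeff_finite_part finite_supported_perms)
    qed
    then show thesis
      using that(2) dist by blast
  qed
qed

text \<open>The truncations to \<open>supported_perms F\<close> lie in \<open>M\<close>, are bounded
  by the norm of \<open>T\<close>, and converge to \<open>T\<close> on delta_1 along the net of
  finite \<open>F\<close>, hence strongly.\<close>

lemma mem_if_supported_left_reg_mem:
  assumes M: "von_neumann_algebra M" and T: "T \<in> P"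
    and left: "\<And>g. op_coeff T g \<noteq> 0 \<Longrightarrow> left_reg g \<in> M"
  shows "T \<in> M"
proof (rule von_neumann_algebra_limit[OF M])
  let ?A = "\<lambda>F. finite_part (supported_perms F) T"
  \<comment> \<open>These finite groups exhaust the whole group: a finite set of permutations is
    contained in the one belonging to the union of their supports.\<close>
  have "filterlim supported_perms (finite_subsets_at_top UNIV) (finite_subsets_at_top (UNIV :: 'a set))"
    unfolding filterlim_finite_subsets_at_top
  proof (intro allI impI)
    fix X :: "'a perm set" assume "finite X \<and> X \<subseteq> UNIV"
    then show "\<forall>\<^sub>F F in finite_subsets_at_top UNIV.
        finite (supported_perms F) \<and> X \<subseteq> supported_perms F \<and> supported_perms F \<subseteq> UNIV"
      unfolding eventually_finite_subsets_at_top
      by (intro exI[of _ "\<Union>s\<in>X. affected s"])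
        (fastforce intro: finite_supported_perms simp: mem_supported_perms)
  qed
  then have lim1: "((\<lambda>F. ?A F (delta 1)) \<longlongrightarrow> T (delta 1)) (finite_subsets_at_top UNIV)"
    unfolding finite_part_delta by (rule filterlim_compose[OF truncate_tendsto])
  have bound: "\<forall>\<^sub>F F in finite_subsets_at_top UNIV. norm (?A F) \<le> norm T"
    using norm_finite_part[OF T] by (intro eventually_finite_subsets_at_top_weakI) auto
  show "((\<lambda>F. ?A F f) \<longlongrightarrow> T f) (finite_subsets_at_top UNIV)" for f
    using T right_inv
    by (intro right_invariant_tendsto[OF finite_part_right_invariant _ bound lim1]) auto
  show "\<forall>\<^sub>F F in finite_subsets_at_top UNIV. ?A F \<in> M"
    by (intro always_eventually allI finite_part_in[OF M] left)
qed simp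

lemma three_cases:
  assumes P: "P \<subseteq> group_vN UNIV"
  shows "P = range scalar_op \<or> P = group_vN {s. evenperm (apply s)} \<or> P = group_vN UNIV"
proof -
  let ?A = "{s :: 'a perm. evenperm (apply s)}"
  have full: "P = group_vN UNIV" if "a \<noteq> b" "left_reg \<langle>a \<leftrightarrow> b\<rangle> \<in> P" for a b
  proof
    show "group_vN UNIV \<subseteq> P"
      unfolding group_vN_def using that all_left_reg_mem vN by (intro hull_minimal) auto
  qed (rule P)
  have alternating: "P = group_vN ?A \<or> P = group_vN UNIV"
    if c: "distinct [a, b, c]" "left_reg (\<langle>a \<leftrightarrow> b\<rangle> * \<langle>b \<leftrightarrow> c\<rangle>) \<in> P" for a b c
  proof (cases "\<exists>T\<in>P. \<exists>g. \<not> evenperm (apply g) \<and> op_coeff T g \<noteq> 0")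
    case True
    then obtain T g where T: "T \<in> P" and g: "\<not> evenperm (apply g)" "op_coeff T g \<noteq> 0"
      by blast
    have ab: "a \<noteq> b" using c by simp
    \<comment> \<open>This product is even because g is odd. Right multiplication of T by u of its
      inverse moves the coefficient at g to the swap of a and b.\<close>
    let ?h = "\<langle>a \<leftrightarrow> b\<rangle> * g"
    have "left_reg (inverse ?h) \<in> P"
      using c ab g
      by (intro even_left_reg_mem[OF c(2,1)])
        (simp add: apply_inverse evenperm_inv permutation_apply evenperm_swap_mult
          del: perm.inverse_distrib_swap)
    then have "T o\<^sub>L left_reg (inverse g * \<langle>a \<leftrightarrow> b\<rangle>) \<in> P"
      using T by (simp add: vN_comp[OF vN])
    moreover have "op_coeff (T o\<^sub>L left_reg (inverse g * \<langle>a \<leftrightarrow> b\<rangle>)) \<langle>a \<leftrightarrow> b\<rangle> \<noteq> 0"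
      using T right_inv g by (subst op_coeff_comp_left_reg) (auto simp: swap_mult_cancel)
    ultimately show ?thesis
      using full left_reg_swap_mem ab by blast
  next
    case False
    \<comment> \<open>In this case every nonzero coefficient sits at an even permutation, so each
      element is a strong limit of elements of L(A).\<close>
    have "P \<subseteq> group_vN ?A"
    proof
      fix T assume T: "T \<in> P"
      show "T \<in> group_vN ?A"
      proof (rule mem_if_supported_left_reg_mem[OF von_neumann_algebra_group_vN T])
        fix g assume "op_coeff T g \<noteq> 0"
        then have "g \<in> ?A"
          using False T by auto
        then show "left_reg g \<in> group_vN ?A"
          unfolding group_vN_def by (auto intro: hull_inc)
      qed
    qed
    moreover have "group_vN ?A \<subseteq> P"
      unfolding group_vN_def using c even_left_reg_mem vN by (intro hull_minimal) auto
    ultimately show ?thesis by blast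
  qed
  show ?thesis
  proof (cases "\<exists>T\<in>P. \<exists>g. g \<noteq> 1 \<and> op_coeff T g \<noteq> 0")
    case True
    then obtain T g where Tg: "T \<in> P" "g \<noteq> 1" "op_coeff T g \<noteq> 0"
      by blast
    from Tg show ?thesis
    proof (cases rule: swap_or_three_cycle_mem)
      case (1 a b)
      then show ?thesis using full by simp
    next
      case (2 a b c)
      then show ?thesis using alternating by simp
    qed
  next
    case False
    have "T \<in> range scalar_op" if "T \<in> P" for T
      using right_invariant_scalarI[of T] False that right_inv by blast
    then have "P = range scalar_op"
      using vN_scalar[OF vN] by blast
    then show ?thesis ..
  qed
qed

end

lemma infinite_pos_nat: "infinite (UNIV :: pos_nat set)"
proof
  assume "finite (UNIV :: pos_nat set)"
  then have "finite (range Rep_pos_nat)"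
    by simp
  also have "range Rep_pos_nat = {1..}"
    using type_definition.Rep_range[OF type_definition_pos_nat] by auto
  finally show False
    using infinite_Ici by blast
qed

theorem theorem1p1:
  fixes P :: "(S_N ell2 \<Rightarrow>\<^sub>L S_N ell2) set"
  assumes "invariant_subalgebra P"
  shows "P = range scalar_op \<or> P = group_vN A_N \<or> P = group_vN UNIV"
proof -
  have P: "von_neumann_algebra P" "P \<subseteq> group_vN UNIV" "\<And>g. conj_op g ` P = P"
    using assms unfolding invariant_subalgebra_def conj_op_def by auto
  interpret invariant_vN P
  proof
    show "infinite (UNIV :: pos_nat set)" "von_neumann_algebra P"
      by (fact infinite_pos_nat, fact P)
    show "P \<subseteq> right_invariant"
      using P(2) group_vN_right_invariant by blast
    show "conj_op g T \<in> P" if "T \<in> P" for g T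
      using P(3)[of g] that by blast
  qed
  show ?thesis
    using three_cases[OF P(2)] unfolding A_N_def .
qed

end
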